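(* Let $m\in\mathbb{N}$, $0<\gamma<n$, $0<\delta<\min\{1,(n-\gamma)/m\}$ and $b\in\Lambda(\delta)$. If $q=n/(n-\gamma-m\delta)$, $u\in A_1$ is a weight on $\mathbb{R}^n$ and $v(x)=|x|^\beta$ with $\beta<-n$, then there exists a positive constant $C$ such that the inequality \[uv^q\left(\left\{x\in\mathbb{R}^n: \frac{|I_{\gamma,b}^m(fv)(x)|}{v(x)}>t\right\}\right)^{1/q}\leq \frac{C}{t}\,\|b\|_{\Lambda(\delta)}^m\int_{\mathbb{R}^n}|f(x)|\,u^{1/q}(x)\,v(x)\,dx\] holds for every $t>0$ and every bounded (measurable) function $f$ with compact support.
   Context: A weight is a locally integrable function $w$ on $\mathbb{R}^n$ with $0<w(x)<\infty$ for almost every $x$. For a nonnegative measurable function $w$ and a measurable set $E$, $w(E)=\int_E w(x)\,dx$; thus $uv^q(E)=\int_E u(x)v(x)^q\,dx$. Cubes have sides parallel to the coordinate axes. A weight $w$ belongs to $A_1$ if there is a constant $C>0$ with $\frac1{|Q|}\int_Q w\leq C\inf_Q w$ (essential infimum) for every cube $Q\subseteq\mathbb{R}^n$. For $0<\delta\leq 1$, a locally integrable function $b$ belongs to $\Lambda(\delta)$ if there is a constant $C>0$ with $|b(x)-b(y)|\leq C|x-y|^\delta$ for every $x,y\in\mathbb{R}^n$; the smallest such $C$ is denoted $\|b\|_{\Lambda(\delta)}$. The fractional integral operator is $I_\gamma g(x)=\int_{\mathbb{R}^n}\frac{g(y)}{|x-y|^{n-\gamma}}\,dy$, defined for every $g$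 such that the integral is finite for almost every $x$. For an operator $T$ and a locally integrable $b$, the commutator is $T_bf=[b,T]f=bTf-T(bf)$, and the higher order commutators are given recursively by $T_b^1=T_b$, $T_b^m=[b,T_b^{m-1}]$ for $m\ge 2$. For $T=I_\gamma$ the commutator of order $m$ is denoted $I_{\gamma,b}^m$. *)

theory Defs
  imports "HOL-Analysis.Analysis"
begin

text \<open>Real powers on the extended half line; used only with exponent \<open>p > 0\<close>, where
  \<open>0\<close> is mapped to \<open>0\<close> and \<open>\<infinity>\<close> to \<open>\<infinity>\<close>.\<close>

definition ennpowr :: "ennreal \<Rightarrow> real \<Rightarrow> ennreal"
  where "ennpowr a p = (if a = \<infinity> then \<infinity> else ennreal (enn2real a powr p))"

definition is_weight :: "(real ^ 'n \<Rightarrow> ennreal) \<Rightarrow> bool"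
  where "is_weight w \<longleftrightarrow>
    w \<in> borel_measurable lebesgue \<and>
    (\<forall>K. compact K \<longrightarrow> (\<integral>\<^sup>+x\<in>K. w x \<partial>lebesgue) < \<infinity>) \<and>
    (AE x in lebesgue. 0 < w x \<and> w x < \<infinity>)"

definition wmeasure :: "(real ^ 'n \<Rightarrow> ennreal) \<Rightarrow> (real ^ 'n) set \<Rightarrow> ennreal"
  where "wmeasure w E = (\<integral>\<^sup>+x\<in>E. w x \<partial>lebesgue)"

definition is_cube :: "(real ^ 'n) set \<Rightarrow> bool"
  where "is_cube Q \<longleftrightarrow> (\<exists>a h. h > 0 \<and> Q = cbox a (\<chi> i. a $ i + h))"

definition ess_inf_on :: "(real ^ 'n) set \<Rightarrow> (real ^ 'n \<Rightarrow> ennreal) \<Rightarrow> ennreal"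
  where "ess_inf_on Q w = Sup {c. AE x in lebesgue. x \<in> Q \<longrightarrow> c \<le> w x}"

definition A1_weight :: "(real ^ 'n \<Rightarrow> ennreal) \<Rightarrow> bool"
  where "A1_weight w \<longleftrightarrow> is_weight w \<and>
    (\<exists>C::real. C > 0 \<and>
      (\<forall>Q. is_cube Q \<longrightarrow> wmeasure w Q / emeasure lebesgue Q \<le> ennreal C * ess_inf_on Q w))"

definition locally_integrable :: "(real ^ 'n \<Rightarrow> real) \<Rightarrow> bool"
  where "locally_integrable b \<longleftrightarrow> (\<forall>K. compact K \<longrightarrow> set_integrable lebesgue K b)"

definition Lipschitz_consts :: "real \<Rightarrow> (real ^ 'n \<Rightarrow> real) \<Rightarrow> real set"
  where "Lipschitz_consts \<delta> b = {C. C > 0 \<and> (\<forall>x y. \<bar>b x - b y\<bar> \<le> C * norm (x - y) powr \<delta>)}"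

definition Lambda_space :: "real \<Rightarrow> (real ^ 'n \<Rightarrow> real) set"
  where "Lambda_space \<delta> = {b. locally_integrable b \<and> Lipschitz_consts \<delta> b \<noteq> {}}"

text \<open>For non-constant \<open>b\<close> the infimum is attained; for constant \<open>b\<close> it is \<open>0\<close>.\<close>

definition Lambda_norm :: "real \<Rightarrow> (real ^ 'n \<Rightarrow> real) \<Rightarrow> real"
  where "Lambda_norm \<delta> b = Inf (Lipschitz_consts \<delta> b)"

text \<open>The operator is total here: at points where the integral does not converge absolutely
  the Bochner integral is \<open>0\<close>. On the natural domain (absolute convergence almost everywhere)
  this changes values on a null set only.\<close>

definition frac_integral :: "real \<Rightarrow> (real ^ 'n \<Rightarrow> real) \<Rightarrow> real ^ 'n \<Rightarrow> real"
  where "frac_integral \<gamma> g x =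
    (\<integral>y. g y / norm (x - y) powr (real CARD('n) - \<gamma>) \<partial>lebesgue)"

definition commutator ::
    "('a \<Rightarrow> real) \<Rightarrow> (('a \<Rightarrow> real) \<Rightarrow> 'a \<Rightarrow> real) \<Rightarrow> ('a \<Rightarrow> real) \<Rightarrow> 'a \<Rightarrow> real"
  where "commutator b T f = (\<lambda>x. b x * T f x - T (\<lambda>y. b y * f y) x)"

primrec iter_commutator ::
    "nat \<Rightarrow> ('a \<Rightarrow> real) \<Rightarrow> (('a \<Rightarrow> real) \<Rightarrow> 'a \<Rightarrow> real) \<Rightarrow> ('a \<Rightarrow> real) \<Rightarrow> 'a \<Rightarrow> real"
  where
    "iter_commutator 0 b T = T"
  | "iter_commutator (Suc m) b T = commutator b (iter_commutator m b T)"

end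

theory Submission
  imports Defs
begin

text \<open>
  Put \<open>\<alpha> = \<gamma> + m \<delta>\<close>, so that \<open>q = n / (n - \<alpha>) > 1\<close>. The commutator is the integral operator with kernel
  \<open>(b x - b y)\<^sup>m \<bar>x - y\<bar> powr (\<gamma> - n)\<close>, hence dominated by \<open>\<parallel>b\<parallel>\<^sup>m\<close> times the Riesz potential of
  order \<open>\<alpha>\<close> of \<open>\<bar>f\<bar> v\<close>. Since \<open>q > 1\<close>, weak \<open>L\<^sup>q\<close> is normable, so a weak type bound for a positive
  integral operator on \<open>L\<^sup>1\<close> only has to be checked on the single kernel sections
  \<open>K\<^sub>y x = \<bar>x - y\<bar> powr (\<alpha> - n) / v x\<close> with respect to \<open>u v\<^sup>q dx\<close>. With \<open>B = - \<beta> q > n\<close> this says that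
  the integral of \<open>u x \<bar>x\<bar> powr (- B)\<close> over \<open>{x. s \<bar>x - y\<bar>\<^sup>n < \<bar>x\<bar> powr B}\<close> is at most a constant times \<open>u y / s\<close>.
  It follows from the pointwise form \<open>u (ball y r) \<le> A r\<^sup>n u y\<close> of the \<open>A\<^sub>1\<close> condition by distinguishing
  \<open>\<bar>x\<bar> < \<bar>y\<bar> / 2\<close>, \<open>\<bar>x\<bar>\<close> comparable to \<open>\<bar>y\<bar>\<close>, and \<open>\<bar>x\<bar> > 2 \<bar>y\<bar>\<close>; only the last region needs \<open>B > n\<close>.
\<close>

section \<open>A kernel form of the normability of weak Lebesgue spaces\<close>

text \<open>Induction on \<open>J\<close>. Once \<open>k\<close> exceeds \<open>2 ^ J * a\<close>,
  all \<open>Suc J\<close> indicators equal 1 and the geometric sum gives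
  \<open>a + (2 ^ Suc J - 1) * a = 2 ^ Suc J * a\<close>, exactly the assumed bound. Otherwise the
  new summand is merely nonnegative.\<close>

lemma dyadic_majorant_aux:
  fixes k a :: real
  assumes "a > 0" "k \<le> 2 ^ J * a"
  shows "k \<le> a + (\<Sum>j<J. 2 ^ j * a * indicator {2 ^ j * a<..} k)"
  using assms(2)
proof (induction J)
  case 0 then show ?case by simp
next
  case (Suc J)
  show ?case
  proof (cases "k \<le> 2 ^ J * a")
    case True
    have "0 \<le> 2 ^ J * a * (indicator {2 ^ J * a<..} k :: real)"
      using assms(1) by simp
    with Suc.IH[OF True] show ?thesis by simp
  next
    case False
    have "indicator {2 ^ j * a<..} k = (1::real)" if "j < Suc J" for j
    proof -
      have "2 ^ j * a \<le> 2 ^ J * a"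
        using that assms(1) by (intro mult_right_mono power_increasing) auto
      with False show ?thesis by (simp add: indicator_def)
    qed
    then have "(\<Sum>j<Suc J. 2 ^ j * a * indicator {2 ^ j * a<..} k) = (\<Sum>j<Suc J. 2 ^ j) * a"
      by (simp add: sum_distrib_right del: sum.lessThan_Suc)
    also have "(\<Sum>j<Suc J. 2 ^ j) = (2::real) ^ Suc J - 1"
      by (simp add: geometric_sum del: sum.lessThan_Suc)
    finally show ?thesis using Suc.prems by (simp add: algebra_simps)
  qed
qed

text \<open>Letting the number of levels be infinite removes the bound on \<open>k\<close>.
  Integrated over a set, the right side involves only measures of dyadic superlevel sets, which is
  what a weak type hypothesis controls.\<close>

lemma dyadic_majorant:
  fixes k a :: real
  assumes "a > 0"
  shows "ennreal k \<le> ennreal a + (\<Sum>j. ennreal (2 ^ j * a) * indicator {2 ^ j * a<..} k)"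
proof -
  obtain J where "k / a < 2 ^ J" using real_arch_pow[of 2 "k / a"] by auto
  then have "k \<le> 2 ^ J * a" using assms by (simp add: field_simps)
  from dyadic_majorant_aux[OF assms this]
  have "ennreal k \<le> ennreal (a + (\<Sum>j<J. 2 ^ j * a * indicator {2 ^ j * a<..} k))"
    by (rule ennreal_leI)
  also have "\<dots> = ennreal a + (\<Sum>j<J. ennreal (2 ^ j * a * indicator {2 ^ j * a<..} k))"
  proof -
    have "0 \<le> 2 ^ j * a * (indicator {2 ^ j * a<..} k :: real)" for j
      using assms by simp
    then show ?thesis using assms by (simp only: ennreal_plus sum_nonneg sum_ennreal less_imp_le)
  qed
  also have "\<dots> = ennreal a + (\<Sum>j<J. ennreal (2 ^ j * a) * indicator {2 ^ j * a<..} k)"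
    using assms by (simp add: ennreal_mult ennreal_indicator)
  also have "\<dots> \<le> ennreal a + (\<Sum>j. ennreal (2 ^ j * a) * indicator {2 ^ j * a<..} k)"
    by (intro add_left_mono sum_le_suminf) auto
  finally show ?thesis .
qed

lemma suminf_ennreal_geometric:
  fixes c r :: real
  assumes "0 \<le> c" "0 \<le> r" "r < 1"
  shows "(\<Sum>j. ennreal (c * r ^ j)) = ennreal (c / (1 - r))"
proof -
  have "(\<lambda>j. c * r ^ j) sums (c * (1 / (1 - r)))"
    using assms by (intro sums_mult geometric_sums) auto
  then show ?thesis using assms by (intro suminf_ennreal_eq) auto
qed

text \<open>This is Kolmogorov's inequality. Below the height \<open>l\<close> the set
  \<open>S\<close> contributes at most \<open>l * a\<close>. Above it, the level
  \<open>2 ^ j * l\<close> contributes at most \<open>D * (2 ^ j * l) powr (1 - q)\<close>, a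
  geometric series with ratio \<open>2 powr (1 - q) < 1\<close> because
  \<open>q > 1\<close>.\<close>

lemma nn_integral_weak_type_bound:
  fixes M :: "'a measure" and K :: "'a \<Rightarrow> real" and q D a :: real
  assumes [measurable]: "K \<in> borel_measurable M" "S \<in> sets M"
    and q: "q > 1" and D: "D > 0" and a: "a > 0" and S: "emeasure M S = ennreal a"
    and weak: "\<And>t. t > 0 \<Longrightarrow> emeasure M {x \<in> space M. t < K x} \<le> ennreal (D * t powr (- q))"
  shows "(\<integral>\<^sup>+x\<in>S. ennreal (K x) \<partial>M)
    \<le> ennreal ((1 + 1 / (1 - 2 powr (1 - q))) * (D powr (1 / q) * a powr (1 - 1 / q)))"
proof -
  \<comment> \<open>This height balances the two contributions: \<open>l * a\<close> and
    \<open>D * l powr (1 - q)\<close> become the same number.\<close>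
  define l where "l = (D / a) powr (1 / q)"
  have l: "l > 0" using D a by (simp add: l_def)
  define r where "r = (2::real) powr (1 - q)"
  have r: "0 < r" "r < 1" using q by (auto simp: r_def powr_less_one)
  have l1: "l * a = D powr (1 / q) * a powr (1 - 1 / q)"
    using D a by (simp add: l_def powr_divide powr_diff field_simps)
  have l2: "D * l powr (1 - q) = D powr (1 / q) * a powr (1 - 1 / q)"
  proof -
    have "l powr (1 - q) = l * l powr (- q)"
      using l by (simp add: powr_diff powr_minus field_simps)
    also have "l powr (- q) = a / D"
      using D a q by (simp add: l_def powr_powr powr_minus)
    finally show ?thesis using l1 D by simp
  qed
  have "(\<integral>\<^sup>+x\<in>S. ennreal (K x) \<partial>M) \<le>
     (\<integral>\<^sup>+x. ennreal l * indicator S x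
        + (\<Sum>j. ennreal (2 ^ j * l) * indicator {x \<in> space M. 2 ^ j * l < K x} x) \<partial>M)"
  proof (rule nn_integral_mono)
    fix x assume x: "x \<in> space M"
    show "ennreal (K x) * indicator S x \<le> ennreal l * indicator S x
        + (\<Sum>j. ennreal (2 ^ j * l) * indicator {x \<in> space M. 2 ^ j * l < K x} x)"
    proof (cases "x \<in> S")
      case True
      have "ennreal (K x) \<le> ennreal l + (\<Sum>j. ennreal (2 ^ j * l) * indicator {2 ^ j * l<..} (K x))"
        by (rule dyadic_majorant[OF l])
      also have "(\<lambda>j. ennreal (2 ^ j * l) * indicator {2 ^ j * l<..} (K x))
          = (\<lambda>j. ennreal (2 ^ j * l) * indicator {x \<in> space M. 2 ^ j * l < K x} x)"
        using x by (auto simp: indicator_def)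
      finally show ?thesis using True by simp
    qed simp
  qed
  also have "\<dots> = ennreal l * emeasure M S
      + (\<Sum>j. ennreal (2 ^ j * l) * emeasure M {x \<in> space M. 2 ^ j * l < K x})"
    by (subst nn_integral_add, simp, simp, subst nn_integral_suminf)
       (auto simp: nn_integral_cmult_indicator)
  also have "\<dots> \<le> ennreal (l * a) + (\<Sum>j. ennreal (D * l powr (1 - q) * r ^ j))"
  proof (intro add_mono suminf_le)
    show "ennreal l * emeasure M S \<le> ennreal (l * a)" using l a S by (simp add: ennreal_mult)
    fix j
    have "ennreal (2 ^ j * l) * emeasure M {x \<in> space M. 2 ^ j * l < K x}
       \<le> ennreal (2 ^ j * l) * ennreal (D * (2 ^ j * l) powr (- q))"
      using l by (intro mult_left_mono weak) auto
    also have "\<dots> = ennreal (D * ((2 ^ j * l) * (2 ^ j * l) powr (- q)))"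
      using l D by (simp add: ennreal_mult[symmetric] mult_ac)
    also have "(2 ^ j * l) * (2 ^ j * l) powr (- q) = (2 ^ j * l) powr (1 - q)"
      using l by (simp add: powr_diff powr_minus field_simps)
    also have "\<dots> = l powr (1 - q) * r ^ j"
      using l by (simp add: r_def powr_mult powr_powr powr_realpow[symmetric] mult_ac)
    finally show "ennreal (2 ^ j * l) * emeasure M {x \<in> space M. 2 ^ j * l < K x}
        \<le> ennreal (D * l powr (1 - q) * r ^ j)" by (simp add: mult_ac)
  qed auto
  also have "\<dots> = ennreal (l * a) + ennreal (D * l powr (1 - q) / (1 - r))"
    using r D by (subst suminf_ennreal_geometric) auto
  also have "\<dots> = ennreal ((1 + 1 / (1 - r)) * (D powr (1 / q) * a powr (1 - 1 / q)))"
    using r D l a unfolding l1 l2 by (subst ennreal_plus[symmetric]) (auto simp: algebra_simps)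
  finally show ?thesis by (simp add: r_def)
qed

text \<open>Minkowski's inequality for weak \<open>L^q\<close>, in duality form. For
  \<open>S\<close> inside the superlevel set, \<open>t\<close> times the measure \<open>a\<close> of
  \<open>S\<close> is at most the double integral of \<open>K\<close> over \<open>S\<close>.
  Tonelli's theorem and Kolmogorov's inequality for each section bound this by a multiple of
  \<open>a powr (1 - 1 / q) * X\<close>, and cancelling this power of \<open>a\<close> leaves the
  claim.\<close>

lemma weak_type_nn_integral_kernel:
  fixes M :: "'a measure" and N :: "'b measure" and K :: "'a \<Rightarrow> 'b \<Rightarrow> real" and D :: "'b \<Rightarrow> real"
  assumes "sigma_finite_measure M" "sigma_finite_measure N"
    and [measurable]: "(\<lambda>p. K (fst p) (snd p)) \<in> borel_measurable (M \<Otimes>\<^sub>M N)"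
    and [measurable]: "D \<in> borel_measurable N"
    and q: "q > 1" and t: "t > 0" and X: "X \<ge> 0"
    and weak: "AE y in N. D y > 0 \<and> (\<forall>s>0. emeasure M {x \<in> space M. s < K x y} \<le> ennreal (D y * s powr (- q)))"
    and D: "(\<integral>\<^sup>+y. ennreal (D y powr (1 / q)) \<partial>N) \<le> ennreal X"
  shows "emeasure M {x \<in> space M. ennreal t < (\<integral>\<^sup>+y. ennreal (K x y) \<partial>N)}
    \<le> ennreal (((1 + 1 / (1 - 2 powr (1 - q))) * X / t) powr q)"
proof -
  interpret M: sigma_finite_measure M by fact
  interpret N: sigma_finite_measure N by fact
  interpret P: pair_sigma_finite M N ..
  define c where "c = 1 + 1 / (1 - 2 powr (1 - q))"
  have "2 powr (1 - q) < 1" using q by (auto simp: powr_less_one)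
  then have c: "c > 0" by (simp add: c_def add_pos_pos)
  define E where "E = {x \<in> space M. ennreal t < (\<integral>\<^sup>+y. ennreal (K x y) \<partial>N)}"
  have [measurable]: "(\<lambda>x. \<integral>\<^sup>+y. ennreal (K x y) \<partial>N) \<in> borel_measurable M"
    using assms(3) by (intro N.borel_measurable_nn_integral) (simp add: case_prod_beta)
  have E [measurable]: "E \<in> sets M" unfolding E_def by measurable
  \<comment> \<open>sets of finite measure, so that a power of \<open>emeasure M S\<close> may be cancelled below\<close>
  have fin: "emeasure M S \<le> ennreal ((c * X / t) powr q)"
    if S [measurable]: "S \<in> sets M" and SE: "S \<subseteq> E" and Sfin: "emeasure M S \<noteq> \<infinity>" for S
  proof (cases "emeasure M S = 0")
    case False
    define a where "a = enn2real (emeasure M S)"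
    have a: "emeasure M S = ennreal a" "a > 0"
      using False Sfin by (auto simp: a_def enn2real_positive_iff top.not_eq_extremum zero_less_iff_neq_zero)
    have "ennreal t * emeasure M S = (\<integral>\<^sup>+x\<in>S. ennreal t \<partial>M)"
      by (simp add: nn_integral_cmult_indicator)
    also have "\<dots> \<le> (\<integral>\<^sup>+x\<in>S. (\<integral>\<^sup>+y. ennreal (K x y) \<partial>N) \<partial>M)"
      using SE by (intro nn_integral_mono) (auto simp: indicator_def E_def less_imp_le)
    also have "\<dots> = (\<integral>\<^sup>+x. (\<integral>\<^sup>+y. ennreal (K x y) * indicator S x \<partial>N) \<partial>M)"
      using measurable_compose_Pair1[OF _ assms(3)]
      by (intro nn_integral_cong nn_integral_multc[symmetric]) simp
    also have "\<dots> = (\<integral>\<^sup>+y. (\<integral>\<^sup>+x. ennreal (K x y) * indicator S x \<partial>M) \<partial>N)"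
    proof (rule P.Fubini'[symmetric])
      have "(\<lambda>p. ennreal (K (fst p) (snd p)) * indicator S (fst p)) \<in> borel_measurable (M \<Otimes>\<^sub>M N)"
        by measurable
      then show "(\<lambda>(x, y). ennreal (K x y) * indicator S x) \<in> borel_measurable (M \<Otimes>\<^sub>M N)"
        by (simp add: case_prod_beta)
    qed
    also have "\<dots> \<le> (\<integral>\<^sup>+y. ennreal (c * a powr (1 - 1 / q)) * ennreal (D y powr (1 / q)) \<partial>N)"
    proof (rule nn_integral_mono_AE)
      from weak AE_space show "AE y in N. (\<integral>\<^sup>+x. ennreal (K x y) * indicator S x \<partial>M)
           \<le> ennreal (c * a powr (1 - 1 / q)) * ennreal (D y powr (1 / q))"
      proof eventually_elim
        case (elim y)
        have "(\<lambda>x. K x y) \<in> borel_measurable M"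
          using measurable_compose[OF measurable_Pair2'[OF elim(2)] assms(3)] by simp
        then have "(\<integral>\<^sup>+x\<in>S. ennreal (K x y) \<partial>M)
          \<le> ennreal ((1 + 1 / (1 - 2 powr (1 - q))) * (D y powr (1 / q) * a powr (1 - 1 / q)))"
          using elim q a by (intro nn_integral_weak_type_bound) auto
        also have "\<dots> = ennreal (c * a powr (1 - 1 / q)) * ennreal (D y powr (1 / q))"
          using c by (simp add: ennreal_mult[symmetric] c_def mult_ac)
        finally show ?case .
      qed
    qed
    also have "\<dots> \<le> ennreal (c * a powr (1 - 1 / q)) * ennreal X"
      using D by (simp add: nn_integral_cmult mult_left_mono)
    finally have "t * a \<le> c * a powr (1 - 1 / q) * X"
      using a t c X by (simp add: ennreal_mult[symmetric])
    then have "a powr (1 / q) \<le> c * X / t"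
      using a t by (simp add: powr_diff field_simps)
    then have "(a powr (1 / q)) powr q \<le> (c * X / t) powr q"
      using q by (intro powr_mono2) auto
    then show ?thesis using a q by (simp add: powr_powr)
  qed simp
  \<comment> \<open>\<open>E\<close> itself may have infinite measure a priori. The bound on its
    pieces of finite measure does not depend on the piece, so it survives the increasing
    limit.\<close>
  obtain A :: "nat \<Rightarrow> 'a set" where A: "range A \<subseteq> sets M" "(\<Union>i. A i) = space M"
      "\<And>i. emeasure M (A i) \<noteq> \<infinity>" "incseq A"
    using M.sigma_finite_incseq by blast
  have "emeasure M E = (SUP i. emeasure M (E \<inter> A i))"
  proof -
    have "(\<Union>i. E \<inter> A i) = E" using A(2) sets.sets_into_space[OF E] by auto
    moreover have "(SUP i. emeasure M (E \<inter> A i)) = emeasure M (\<Union>i. E \<inter> A i)"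
    proof (intro SUP_emeasure_incseq)
      show "incseq (\<lambda>i. E \<inter> A i)" using A(4) by (fastforce simp: incseq_def)
    qed (use A(1) in auto)
    ultimately show ?thesis by simp
  qed
  also have "\<dots> \<le> ennreal ((c * X / t) powr q)"
  proof (rule SUP_least)
    fix i
    have [measurable]: "A i \<in> sets M" using A(1) by auto
    have "emeasure M (E \<inter> A i) \<le> emeasure M (A i)" by (intro emeasure_mono) auto
    with A(3)[of i] show "emeasure M (E \<inter> A i) \<le> ennreal ((c * X / t) powr q)"
      by (intro fin) (auto simp: top_unique)
  qed
  finally show ?thesis by (simp add: E_def c_def)
qed

section \<open>Estimates for \<open>A\<^sub>1\<close> weights\<close>

text \<open>The \<open>A_1\<close> condition bounds the average over a cube by \<open>u y\<close>
  for almost every \<open>y\<close> in that cube. A ball around \<open>y\<close> lies in a cube of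
  comparable size taken from a countable family, so one null set serves all radii at once.\<close>

lemma A1_weight_ball_bound:
  fixes u :: "real ^ 'n \<Rightarrow> ennreal"
  assumes "A1_weight u"
  obtains A where "A > 0"
    "AE y in lebesgue. \<forall>r>0. (\<integral>\<^sup>+x\<in>ball y r. u x \<partial>lebesgue) \<le> ennreal (A * r ^ CARD('n)) * u y"
proof -
  obtain C where C: "C > 0"
    and le: "\<And>Q. is_cube Q \<Longrightarrow> wmeasure u Q / emeasure lebesgue Q \<le> ennreal C * ess_inf_on Q u"
    using assms by (auto simp: A1_weight_def)
  have cube: "AE y in lebesgue. y \<in> cbox a (\<chi> i. a $ i + h) \<longrightarrow>
      wmeasure u (cbox a (\<chi> i. a $ i + h)) \<le> ennreal (C * h ^ CARD('n)) * u y"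
    if h: "h > 0" for a :: "real ^ 'n" and h :: real
  proof -
    define Q where "Q = cbox a (\<chi> i. a $ i + h)"
    have "emeasure lebesgue Q = ennreal (measure lborel Q)"
      using emeasure_lborel_cbox_finite[of a "\<chi> i. a $ i + h"]
      by (auto simp: Q_def intro!: emeasure_eq_ennreal_measure)
    also have "measure lborel Q = h ^ CARD('n)"
    proof -
      have "Q \<noteq> {}" using h by (auto simp: Q_def interval_eq_empty_cart not_less)
      then show ?thesis unfolding Q_def by (subst content_cbox_cart) auto
    qed
    finally have eQ: "emeasure lebesgue Q = ennreal (h ^ CARD('n))" .
    have ess: "AE y in lebesgue. y \<in> Q \<longrightarrow> ess_inf_on Q u \<le> u y"
    proof -
      \<comment> \<open>The essential infimum is a supremum over possibly uncountably many
        \<open>c\<close>. Reaching it along a sequence in \<open>S\<close> leaves only countably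
        many null sets to unite.\<close>
      define S where "S = {c. AE x in lebesgue. x \<in> Q \<longrightarrow> c \<le> u x}"
      have "0 \<in> S" by (simp add: S_def)
      then obtain f :: "nat \<Rightarrow> ennreal" where f: "incseq f" "range f \<subseteq> S" "Sup S = (SUP i. f i)"
        using ennreal_Sup_countable_SUP[of S] by auto
      then have "AE x in lebesgue. \<forall>i. x \<in> Q \<longrightarrow> f i \<le> u x"
        unfolding AE_all_countable S_def by blast
      then show ?thesis
        unfolding ess_inf_on_def S_def[symmetric] f(3)
        by eventually_elim (auto intro: SUP_least)
    qed
    have "wmeasure u Q \<le> ennreal (C * h ^ CARD('n)) * ess_inf_on Q u"
    proof -
      have "is_cube Q" using h by (auto simp: is_cube_def Q_def)
      have hp: "h ^ CARD('n) > 0" using h by simp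
      have "wmeasure u Q = wmeasure u Q / emeasure lebesgue Q * ennreal (h ^ CARD('n))"
        using hp h by (simp add: eQ ennreal_divide_times divide_ennreal)
      also have "\<dots> \<le> ennreal C * ess_inf_on Q u * ennreal (h ^ CARD('n))"
        by (intro mult_right_mono le \<open>is_cube Q\<close>) simp
      also have "\<dots> = ennreal (C * h ^ CARD('n)) * ess_inf_on Q u"
        using hp C by (simp add: ennreal_mult mult_ac)
      finally show ?thesis .
    qed
    then have imp: "wmeasure u Q \<le> ennreal (C * h ^ CARD('n)) * u y" if "ess_inf_on Q u \<le> u y" for y
      by (rule order.trans) (intro mult_left_mono that, simp)
    show ?thesis
      using ess unfolding Q_def[symmetric] by (rule eventually_mono) (use imp in blast)
  qed
  \<comment> \<open>Only countably many cubes may be used, so that the exceptional null set depends neither on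
    the ball nor on its centre.\<close>
  obtain D :: "(real ^ 'n) set" where D: "countable D" "\<And>X. open X \<Longrightarrow> X \<noteq> {} \<Longrightarrow> \<exists>d\<in>D. d \<in> X"
    using countable_dense_setE by blast
  have "AE y in lebesgue. \<forall>a\<in>D. \<forall>h\<in>\<rat>\<inter>{0<..}. y \<in> cbox a (\<chi> i. a $ i + h) \<longrightarrow>
      wmeasure u (cbox a (\<chi> i. a $ i + h)) \<le> ennreal (C * h ^ CARD('n)) * u y"
  proof (intro AE_ball_countable')
    show "countable (\<rat> \<inter> {0<..} :: real set)" by (intro countable_Int1 countable_rat)
    fix a :: "real ^ 'n" and h :: real assume "h \<in> \<rat> \<inter> {0<..}"
    then show "AE y in lebesgue. y \<in> cbox a (\<chi> i. a $ i + h) \<longrightarrow>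
      wmeasure u (cbox a (\<chi> i. a $ i + h)) \<le> ennreal (C * h ^ CARD('n)) * u y"
      by (intro cube) simp
  qed (rule D(1))
  then have "AE y in lebesgue. \<forall>r>0.
    (\<integral>\<^sup>+x\<in>ball y r. u x \<partial>lebesgue) \<le> ennreal (C * 4 ^ CARD('n) * r ^ CARD('n)) * u y"
  proof eventually_elim
    case (elim y)
    show ?case
    proof (intro allI impI)
      fix r :: real assume r: "r > 0"
      \<comment> \<open>A corner \<open>a\<close> in this box and a side \<open>h\<close> between
        \<open>3 * r\<close> and \<open>4 * r\<close> give \<open>a $ i < y $ i - r\<close> and
        \<open>a $ i + h > y $ i + r\<close>, so the cube contains \<open>ball y r\<close>. The
        bound \<open>h < 4 * r\<close> produces the factor \<open>4 ^ CARD('n)\<close>.\<close>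
      let ?B = "box (\<chi> i. y $ i - 2 * r) (\<chi> i. y $ i - r)"
      have "?B \<noteq> {}" using r by (auto simp: interval_eq_empty_cart)
      then obtain a where a: "a \<in> D" "a \<in> ?B" using D(2)[of ?B] by auto
      obtain h where h: "h \<in> \<rat>" "3 * r < h" "h < 4 * r"
        using Rats_dense_in_real[of "3 * r" "4 * r"] r by auto
      define Q where "Q = cbox a (\<chi> i. a $ i + h)"
      have sub: "ball y r \<subseteq> Q"
      proof
        fix x assume "x \<in> ball y r"
        then have "\<bar>(x - y) $ i\<bar> < r" for i
          using component_le_norm_cart[of "x - y" i] by (simp add: dist_norm norm_minus_commute)
        moreover have "y $ i - 2 * r < a $ i" "a $ i < y $ i - r" for i
          using a(2) by (auto simp: mem_box_cart)
        ultimately have "a $ i \<le> x $ i \<and> x $ i \<le> a $ i + h" for i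
          using h(2) unfolding vector_minus_component by (smt (verit))
        then show "x \<in> Q"
          by (simp add: Q_def mem_box_cart)
      qed
      then have "y \<in> Q" using r by auto
      then have "wmeasure u Q \<le> ennreal (C * h ^ CARD('n)) * u y"
        using elim a(1) h r by (auto simp: Q_def)
      also have "\<dots> \<le> ennreal (C * 4 ^ CARD('n) * r ^ CARD('n)) * u y"
        using h r C power_mono[of h "4 * r" "CARD('n)"]
        by (intro mult_right_mono ennreal_leI) (auto simp: power_mult_distrib)
      finally have "wmeasure u Q \<le> ennreal (C * 4 ^ CARD('n) * r ^ CARD('n)) * u y" .
      moreover have "(\<integral>\<^sup>+x\<in>ball y r. u x \<partial>lebesgue) \<le> wmeasure u Q"
        using sub unfolding wmeasure_def
        by (intro nn_integral_mono mult_left_mono) (auto simp: indicator_def)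
      ultimately show "(\<integral>\<^sup>+x\<in>ball y r. u x \<partial>lebesgue)
          \<le> ennreal (C * 4 ^ CARD('n) * r ^ CARD('n)) * u y" by (rule order.trans[rotated])
    qed
  qed
  with C show ?thesis by (intro that[of "C * 4 ^ CARD('n)"]) auto
qed

text \<open>For \<open>norm y < R\<close> the ball of radius \<open>2 * R\<close> around
  \<open>y\<close> contains \<open>ball 0 R\<close>, so the ball bound compares \<open>u y\<close>
  from below with the mass of \<open>ball 0 R\<close>. That mass is positive because
  \<open>u > 0\<close> almost everywhere.\<close>

lemma A1_weight_bounded_below:
  fixes u :: "real ^ 'n \<Rightarrow> ennreal"
  assumes "A1_weight u" "R > 0"
  obtains e where "e > 0" "AE y in lebesgue. norm y < R \<longrightarrow> e \<le> enn2real (u y)"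
proof -
  from A1_weight_ball_bound[OF assms(1)] obtain A where A: "A > 0"
    and ball: "AE y in lebesgue. \<forall>r>0. (\<integral>\<^sup>+x\<in>ball y r. u x \<partial>lebesgue) \<le> ennreal (A * r ^ CARD('n)) * u y"
    by blast
  have u [measurable]: "u \<in> borel_measurable lebesgue" and pos: "AE x in lebesgue. 0 < u x \<and> u x < \<infinity>"
    using assms(1) by (auto simp: A1_weight_def is_weight_def)
  define I where "I = (\<integral>\<^sup>+x\<in>ball 0 R. u x \<partial>lebesgue)"
  \<comment> \<open>The truncation at 1 guards against the convention that \<open>enn2real\<close>
    sends \<infinity> to 0.\<close>
  define e where "e = enn2real (min I 1) / (A * (2 * R) ^ CARD('n))"
  have "I \<noteq> 0"
  proof
    have [measurable]: "ball 0 R \<in> sets (lebesgue :: (real ^ 'n) measure)" by simp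
    assume "I = 0"
    then have "AE x in lebesgue. u x * indicator (ball 0 R) x = 0"
      unfolding I_def by (subst (asm) nn_integral_0_iff_AE) auto
    with pos have "AE x in lebesgue. x \<notin> ball (0 :: real ^ 'n) R"
      by eventually_elim (auto simp: indicator_def)
    then have "emeasure lebesgue (ball (0 :: real ^ 'n) R) = 0"
      by (subst (asm) AE_iff_measurable[of "ball 0 R"]) auto
    then show False using assms(2) emeasure_ball[of R "0 :: real ^ 'n"] unit_ball_vol_pos[of "real CARD('n)"] by simp
  qed
  then have "min I 1 \<noteq> 0" by (simp add: min_def)
  moreover have "min I 1 < \<infinity>" by (rule le_less_trans[OF min.cobounded2]) simp
  ultimately have m: "enn2real (min I 1) > 0" "ennreal (enn2real (min I 1)) = min I 1"
    by (auto simp: enn2real_positive_iff zero_less_iff_neq_zero less_top)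
  show ?thesis
  proof (rule that[of e])
    show "e > 0" using m A assms(2) by (simp add: e_def)
    show "AE y in lebesgue. norm y < R \<longrightarrow> e \<le> enn2real (u y)"
      using ball pos
    proof eventually_elim
      case (elim y)
      show ?case
      proof
        assume y: "norm y < R"
        have uy: "u y = ennreal (enn2real (u y))" using elim(2) by simp
        have "ball 0 R \<subseteq> ball y (2 * R)"
        proof
          fix x :: "real ^ 'n" assume "x \<in> ball 0 R"
          then show "x \<in> ball y (2 * R)"
            using y norm_triangle_ineq4[of y x] by (simp add: dist_norm)
        qed
        then have "I \<le> (\<integral>\<^sup>+x\<in>ball y (2 * R). u x \<partial>lebesgue)"
          unfolding I_def by (intro nn_integral_mono mult_left_mono) (auto simp: indicator_def)
        also have "\<dots> \<le> ennreal (A * (2 * R) ^ CARD('n)) * u y"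
          using elim(1)[rule_format, of "2 * R"] assms(2) by simp
        finally have "ennreal (enn2real (min I 1)) \<le> ennreal (A * (2 * R) ^ CARD('n)) * ennreal (enn2real (u y))"
          unfolding m(2) uy[symmetric] by (rule min.coboundedI1)
        then have "enn2real (min I 1) \<le> A * (2 * R) ^ CARD('n) * enn2real (u y)"
          using A assms(2) by (simp add: ennreal_mult[symmetric])
        then show "e \<le> enn2real (u y)"
          using A assms(2) by (simp add: e_def divide_le_eq mult.commute)
      qed
    qed
  qed
qed

text \<open>On the bounded support of \<open>g\<close> the weight is at least some
  \<open>e > 0\<close>, so inserting \<open>ennpowr (u y) p\<close> costs at most the factor
  \<open>e powr - p\<close>. This turns finiteness of the right side of the theorem into
  integrability of \<open>f * v\<close>.\<close>

lemma nn_integral_finite_of_A1_weight: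
  fixes u :: "real ^ 'n \<Rightarrow> ennreal" and g :: "real ^ 'n \<Rightarrow> real"
  assumes "A1_weight u" and g [measurable]: "g \<in> borel_measurable lebesgue"
    and bd: "bounded {x. g x \<noteq> 0}" and p: "p > 0"
    and fin: "(\<integral>\<^sup>+y. ennreal (g y) * ennpowr (u y) p \<partial>lebesgue) < \<infinity>"
  shows "(\<integral>\<^sup>+y. ennreal (g y) \<partial>lebesgue) < \<infinity>"
proof -
  obtain R where R: "R > 0" "\<And>x. g x \<noteq> 0 \<Longrightarrow> norm x < R"
    using bd unfolding bounded_pos_less by auto
  obtain e where e: "e > 0" "AE y in lebesgue. norm y < R \<longrightarrow> e \<le> enn2real (u y)"
    using A1_weight_bounded_below[OF assms(1) R(1)] by blast
  have [measurable]: "u \<in> borel_measurable lebesgue"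
    using assms(1) by (auto simp: A1_weight_def is_weight_def)
  have "(\<integral>\<^sup>+y. ennreal (g y) \<partial>lebesgue)
    \<le> (\<integral>\<^sup>+y. ennreal (e powr - p) * (ennreal (g y) * ennpowr (u y) p) \<partial>lebesgue)"
  proof (rule nn_integral_mono_AE)
    show "AE y in lebesgue. ennreal (g y) \<le> ennreal (e powr - p) * (ennreal (g y) * ennpowr (u y) p)"
      using e(2)
    proof eventually_elim
      case (elim y)
      show ?case
      proof (cases "g y = 0")
        case False
        then have "e powr p \<le> enn2real (u y) powr p"
          using elim R(2)[of y] e(1) p by (intro powr_mono2) auto
        then have "ennreal (e powr p) \<le> ennpowr (u y) p"
          by (simp add: ennpowr_def ennreal_leI)
        then have "ennreal (e powr - p) * ennreal (e powr p) \<le> ennreal (e powr - p) * ennpowr (u y) p"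
          by (rule mult_left_mono) simp
        moreover have "ennreal (e powr - p) * ennreal (e powr p) = 1"
          using e(1) by (simp add: ennreal_mult[symmetric] powr_add[symmetric])
        ultimately have "ennreal (g y) * 1 \<le> ennreal (g y) * (ennreal (e powr - p) * ennpowr (u y) p)"
          by (intro mult_left_mono) auto
        then show ?thesis by (simp add: mult_ac)
      qed simp
    qed
  qed
  also have "\<dots> = ennreal (e powr - p) * (\<integral>\<^sup>+y. ennreal (g y) * ennpowr (u y) p \<partial>lebesgue)"
    unfolding ennpowr_def by (intro nn_integral_cmult) measurable
  also have "\<dots> < \<infinity>" using fin by (simp add: ennreal_mult_less_top)
  finally show ?thesis .
qed

section \<open>Sections of the Riesz kernel against a power weight\<close>

lemma power_two_bracket:
  fixes z :: real
  assumes "1 \<le> z"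
  obtains j where "2 ^ j \<le> z" "z < 2 ^ Suc j"
proof -
  let ?J = "LEAST J. z < 2 ^ J"
  have J: "z < 2 ^ ?J"
    using real_arch_pow[of 2 z] by (auto intro: LeastI_ex)
  with assms obtain j where j: "?J = Suc j" by (cases ?J) auto
  then have "\<not> z < 2 ^ j" by (intro not_less_Least) simp
  with J j show ?thesis by (intro that[of j]) auto
qed

text \<open>The three summands of the constant belong to three regions. For
  \<open>norm x < norm y / 2\<close>, the distance to \<open>y\<close> is at least
  \<open>norm y / 2\<close>, so membership in the set bounds \<open>norm x powr (- B)\<close> by
  \<open>a1\<close>. For \<open>norm x\<close> comparable to \<open>norm y\<close>, that power is at
  most \<open>a2\<close> and membership confines \<open>x\<close> to \<open>ball y r\<close>. For
  \<open>norm x > 2 * norm y\<close>, membership forces \<open>norm x > R\<close>, and dyadic shells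
  starting at \<open>R\<close> sum up because \<open>B > n\<close>. In the first two regions all
  powers of \<open>norm y\<close> cancel.\<close>

lemma power_weight_kernel_bound:
  fixes u :: "'a::euclidean_space \<Rightarrow> ennreal" and y :: 'a and c :: ennreal and A B s :: real
  assumes u [measurable]: "u \<in> borel_measurable lebesgue"
    and B: "B > real DIM('a)" and A: "A > 0" and y: "y \<noteq> 0" and s: "s > 0"
    and ball: "\<And>r. r > 0 \<Longrightarrow>
      (\<integral>\<^sup>+x\<in>ball y r. u x \<partial>lebesgue) \<le> ennreal (A * r ^ DIM('a)) * c"
  shows "(\<integral>\<^sup>+x\<in>{x. s * norm (x - y) ^ DIM('a) < norm x powr B}. u x * ennreal (norm x powr (- B)) \<partial>lebesgue)
    \<le> ennreal (A * (4 ^ DIM('a) + 4 powr B + 8 ^ DIM('a) / (1 - 2 powr (real DIM('a) - B))) / s) * c"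
proof -
  define n where "n = DIM('a)"
  have n: "n > 0" by (simp add: n_def)
  have Bn: "B > real n" "B > 0" using B n by (auto simp: n_def)
  define E where "E = {x::'a. s * norm (x - y) ^ n < norm x powr B}"
  define a1 where "a1 = 1 / (s * (norm y / 2) ^ n)"
  define a2 where "a2 = (norm y / 2) powr (- B)"
  define r where "r = root n ((2 * norm y) powr B / s)"
  \<comment> \<open>In the far region \<open>norm (x - y)\<close> is at least
    \<open>norm x / 2\<close>, which turns membership into
    \<open>s / 2 ^ n < norm x powr (B - n)\<close>. \<open>R\<close> is the solution of the
    corresponding equation.\<close>
  define R where "R = (s / 2 ^ n) powr (1 / (B - n))"
  have r: "r > 0" "r ^ n = (2 * norm y) powr B / s"
    using y s n by (auto simp: r_def)
  have R: "R > 0" "R powr (n - B) = 2 ^ n / s"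
  proof -
    show "R > 0" using s by (simp add: R_def)
    have "(1 / (B - n)) * (n - B) = -1" using Bn by (simp add: field_simps)
    then have "R powr (n - B) = (s / 2 ^ n) powr (-1)"
      by (simp only: R_def powr_powr)
    then show "R powr (n - B) = 2 ^ n / s" using s by (simp add: powr_minus_divide)
  qed
  \<comment> \<open>\<open>g j\<close> majorizes the integrand on the shell where
    \<open>norm x\<close> lies between \<open>2 ^ j * R\<close> and twice that. There
    \<open>norm (x - y) < 2 * norm x\<close>, hence the radius
    \<open>2 ^ j * (4 * R)\<close>.\<close>
  define g where "g j x = ennreal ((2 ^ j * R) powr (- B)) * (u x * indicator (ball y (2 ^ j * (4 * R))) x)"
    for j :: nat and x
  have sum3: "a \<le> a + b + c" "b \<le> a + b + c" "c \<le> a + b + c" for a b c :: ennreal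
    by (simp_all add: add_increasing add_increasing2)
  have pos: "a1 \<ge> 0" "a2 \<ge> 0" using s by (auto simp: a1_def a2_def)
  have [measurable]: "ball y \<rho> \<in> sets lebesgue" for \<rho> by simp
  have "(\<integral>\<^sup>+x\<in>E. u x * ennreal (norm x powr (- B)) \<partial>lebesgue)
    \<le> (\<integral>\<^sup>+x. ennreal a1 * (u x * indicator (ball y (2 * norm y)) x)
        + ennreal a2 * (u x * indicator (ball y r) x) + (\<Sum>j. g j x) \<partial>lebesgue)"
  proof (rule nn_integral_mono)
    fix x :: 'a
    show "u x * ennreal (norm x powr (- B)) * indicator E x \<le>
        ennreal a1 * (u x * indicator (ball y (2 * norm y)) x)
        + ennreal a2 * (u x * indicator (ball y r) x) + (\<Sum>j. g j x)"
    proof (cases "x \<in> E")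
      case True
      then have E: "s * norm (x - y) ^ n < norm x powr B" by (simp add: E_def)
      have "0 \<le> s * norm (x - y) ^ n" using s by simp
      with E have "x \<noteq> 0" by auto
      then have x: "norm x > 0" by simp
      have le: "u x * ennreal (norm x powr (- B)) * indicator E x \<le> ennreal a * (u x * indicator S x)"
        if "x \<in> S" "norm x powr (- B) \<le> a" for a S
      proof -
        have "u x * ennreal (norm x powr (- B)) \<le> u x * ennreal a"
          by (intro mult_left_mono ennreal_leI that) simp
        then show ?thesis using True that(1) by (simp add: mult.commute)
      qed
      consider "norm x < norm y / 2" | "norm y / 2 \<le> norm x" "norm x \<le> 2 * norm y"
        | "2 * norm y < norm x" by linarith
      then show ?thesis
      proof cases
        case 1
        have d: "norm y / 2 \<le> norm (x - y)" "norm (x - y) < 2 * norm y"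
          using 1 norm_triangle_ineq2[of y x] norm_triangle_ineq4[of x y] norm_minus_commute[of y x]
            norm_ge_zero[of x] by linarith+
        have "s * (norm y / 2) ^ n \<le> s * norm (x - y) ^ n"
          using d s by (intro mult_left_mono power_mono) auto
        with E have "s * (norm y / 2) ^ n \<le> norm x powr B" by linarith
        then have "norm x powr (- B) \<le> a1"
          unfolding a1_def powr_minus_divide
          using s y \<open>x \<noteq> 0\<close> by (intro divide_left_mono mult_pos_pos) auto
        moreover have "x \<in> ball y (2 * norm y)"
          using d by (simp add: dist_norm norm_minus_commute)
        ultimately have "u x * ennreal (norm x powr (- B)) * indicator E x
            \<le> ennreal a1 * (u x * indicator (ball y (2 * norm y)) x)"
          by (intro le)
        then show ?thesis by (rule order.trans[OF _ sum3(1)])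
      next
        case 2
        have "s * norm (x - y) ^ n < (2 * norm y) powr B"
          using E powr_mono2[of B "norm x" "2 * norm y"] 2 Bn by auto
        then have "norm (x - y) ^ n < r ^ n" using s by (simp add: r field_simps)
        then have "norm (x - y) < r" by (rule power_less_imp_less_base) (use r(1) in simp)
        then have "x \<in> ball y r" by (simp add: dist_norm norm_minus_commute)
        moreover have "norm x powr (- B) \<le> a2"
          using 2 y Bn unfolding a2_def by (intro powr_mono2') auto
        ultimately have "u x * ennreal (norm x powr (- B)) * indicator E x
            \<le> ennreal a2 * (u x * indicator (ball y r) x)"
          by (intro le)
        then show ?thesis by (rule order.trans[OF _ sum3(2)])
      next
        case 3
        have d: "norm x / 2 \<le> norm (x - y)" "norm (x - y) < 2 * norm x"
          using 3 norm_triangle_ineq2[of x y] norm_triangle_ineq4[of x y] x by linarith+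
        have "s * (norm x / 2) ^ n \<le> s * norm (x - y) ^ n"
          using d s by (intro mult_left_mono power_mono) auto
        with E have "s / 2 ^ n * norm x powr n < norm x powr B"
          using x by (simp add: power_divide powr_realpow)
        then have "s / 2 ^ n < norm x powr (B - n)"
          using x by (simp add: powr_diff field_simps)
        then have "R < (norm x powr (B - n)) powr (1 / (B - n))"
          unfolding R_def using s Bn by (intro powr_less_mono2) auto
        then have "R < norm x" using Bn x by (simp add: powr_powr)
        then have "1 \<le> norm x / R" using R by simp
        then obtain j where "2 ^ j \<le> norm x / R" "norm x / R < 2 ^ Suc j"
          by (rule power_two_bracket)
        then have j: "2 ^ j * R \<le> norm x" "norm x < 2 * (2 ^ j * R)"
          using R by (auto simp: field_simps)
        have "x \<in> ball y (2 ^ j * (4 * R))"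
          using d j by (simp add: dist_norm norm_minus_commute)
        moreover have "norm x powr (- B) \<le> (2 ^ j * R) powr (- B)"
          using j R Bn by (intro powr_mono2') auto
        ultimately have "u x * ennreal (norm x powr (- B)) * indicator E x \<le> g j x"
          unfolding g_def by (intro le)
        also have "\<dots> \<le> (\<Sum>j. g j x)"
          using sum_le_suminf[of "\<lambda>j. g j x" "{j}"] by simp
        finally show ?thesis by (rule order.trans[OF _ sum3(3)])
      qed
    qed simp
  qed
  also have "\<dots> = ennreal a1 * (\<integral>\<^sup>+x\<in>ball y (2 * norm y). u x \<partial>lebesgue)
      + ennreal a2 * (\<integral>\<^sup>+x\<in>ball y r. u x \<partial>lebesgue)
      + (\<Sum>j. ennreal ((2 ^ j * R) powr (- B)) * (\<integral>\<^sup>+x\<in>ball y (2 ^ j * (4 * R)). u x \<partial>lebesgue))"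
  proof -
    have [measurable]: "(\<lambda>x. u x * indicator (ball y \<rho>) x) \<in> borel_measurable lebesgue" for \<rho>
      by measurable
    have [measurable]: "g j \<in> borel_measurable lebesgue" for j
      unfolding g_def by measurable
    have comb: "(\<integral>\<^sup>+x. ennreal a1 * F x + ennreal a2 * G x + H x \<partial>lebesgue)
        = ennreal a1 * (\<integral>\<^sup>+x. F x \<partial>lebesgue) + ennreal a2 * (\<integral>\<^sup>+x. G x \<partial>lebesgue)
          + (\<integral>\<^sup>+x. H x \<partial>lebesgue)"
      if [measurable]: "F \<in> borel_measurable lebesgue" "G \<in> borel_measurable lebesgue"
        "H \<in> borel_measurable lebesgue" for F G H :: "'a \<Rightarrow> ennreal"
      by (simp add: nn_integral_add nn_integral_cmult)
    have "(\<integral>\<^sup>+x. (\<Sum>j. g j x) \<partial>lebesgue) = (\<Sum>j. \<integral>\<^sup>+x. g j x \<partial>lebesgue)"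
      by (rule nn_integral_suminf) measurable
    also have "\<dots> = (\<Sum>j. ennreal ((2 ^ j * R) powr (- B)) *
        (\<integral>\<^sup>+x\<in>ball y (2 ^ j * (4 * R)). u x \<partial>lebesgue))"
      unfolding g_def by (intro suminf_cong nn_integral_cmult) measurable
    finally have sum: "(\<integral>\<^sup>+x. (\<Sum>j. g j x) \<partial>lebesgue) = \<dots>" .
    show ?thesis
      unfolding sum[symmetric] by (rule comb) measurable
  qed
  also have "\<dots> \<le> ennreal (A * 4 ^ n / s) * c + ennreal (A * 4 powr B / s) * c
      + (\<Sum>j. ennreal (A * 8 ^ n / s * (2 powr (n - B)) ^ j)) * c"
  proof (intro add_mono)
    have "ennreal a1 * (\<integral>\<^sup>+x\<in>ball y (2 * norm y). u x \<partial>lebesgue)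
        \<le> ennreal a1 * (ennreal (A * (2 * norm y) ^ n) * c)"
      using ball[of "2 * norm y"] y by (intro mult_left_mono) (auto simp: n_def)
    also have "\<dots> = ennreal (a1 * (A * (2 * norm y) ^ n)) * c"
      using A pos by (simp add: ennreal_mult mult.assoc)
    also have "a1 * (A * (2 * norm y) ^ n) = A * 4 ^ n / s"
    proof -
      have "(2 * norm y) ^ n = 4 ^ n * (norm y / 2) ^ n"
        using power_mult_distrib[of 4 "norm y / 2" n] by simp
      then show ?thesis using y s by (simp add: a1_def)
    qed
    finally show "ennreal a1 * (\<integral>\<^sup>+x\<in>ball y (2 * norm y). u x \<partial>lebesgue) \<le> ennreal (A * 4 ^ n / s) * c" .
    have "ennreal a2 * (\<integral>\<^sup>+x\<in>ball y r. u x \<partial>lebesgue) \<le> ennreal a2 * (ennreal (A * r ^ n) * c)"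
      using ball[of r] r(1) by (intro mult_left_mono) (auto simp: n_def)
    also have "\<dots> = ennreal (a2 * (A * r ^ n)) * c"
      using A pos r(1) by (simp add: ennreal_mult mult.assoc)
    also have "a2 * (A * r ^ n) = A * 4 powr B / s"
    proof -
      have "(2 * norm y) powr B = 4 powr B * (norm y / 2) powr B"
        using powr_mult[of 4 "norm y / 2" B] by simp
      then show ?thesis using y s by (simp add: a2_def r(2) powr_minus)
    qed
    finally show "ennreal a2 * (\<integral>\<^sup>+x\<in>ball y r. u x \<partial>lebesgue) \<le> ennreal (A * 4 powr B / s) * c" .
    have "(\<Sum>j. ennreal ((2 ^ j * R) powr (- B)) * (\<integral>\<^sup>+x\<in>ball y (2 ^ j * (4 * R)). u x \<partial>lebesgue))
        \<le> (\<Sum>j. ennreal (A * 8 ^ n / s * (2 powr (n - B)) ^ j) * c)"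
    proof (intro suminf_le)
      fix j
      have "ennreal ((2 ^ j * R) powr (- B)) * (\<integral>\<^sup>+x\<in>ball y (2 ^ j * (4 * R)). u x \<partial>lebesgue)
          \<le> ennreal ((2 ^ j * R) powr (- B)) * (ennreal (A * (2 ^ j * (4 * R)) ^ n) * c)"
        using ball[of "2 ^ j * (4 * R)"] R(1) by (intro mult_left_mono) (auto simp: n_def)
      also have "\<dots> = ennreal ((2 ^ j * R) powr (- B) * (A * (2 ^ j * (4 * R)) ^ n)) * c"
        using A R by (simp add: ennreal_mult mult.assoc)
      also have "(2 ^ j * R) powr (- B) * (A * (2 ^ j * (4 * R)) ^ n)
          = A * 4 ^ n * ((2 ^ j * R) powr n * (2 ^ j * R) powr (- B))"
        using R(1) by (simp add: powr_realpow power_mult_distrib)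
      also have "(2 ^ j * R) powr n * (2 ^ j * R) powr (- B) = (2 ^ j * R) powr (n - B)"
        by (simp add: powr_add[symmetric])
      \<comment> \<open>The choice of \<open>R\<close> makes \<open>R powr (n - B)\<close> equal to
        \<open>2 ^ n / s\<close>, which supplies the factor \<open>1 / s\<close>. Its
        \<open>2 ^ n\<close> joins \<open>4 ^ n\<close> from the radii to give
        \<open>8 ^ n\<close>.\<close>
      also have "\<dots> = (2 powr (n - B)) ^ j * (2 ^ n / s)"
      proof -
        have "(2 ^ j * R) powr (n - B) = (2 ^ j) powr (n - B) * (2 ^ n / s)"
          using R by (simp add: powr_mult)
        also have "(2 ^ j :: real) powr (n - B) = (2 powr (n - B)) ^ j"
          by (simp add: powr_realpow[symmetric] powr_powr mult.commute)
        finally show ?thesis .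
      qed
      also have "A * 4 ^ n * ((2 powr (n - B)) ^ j * (2 ^ n / s)) = A * 8 ^ n / s * (2 powr (n - B)) ^ j"
      proof -
        have "(8::real) ^ n = 4 ^ n * 2 ^ n" using power_mult_distrib[of "4::real" 2 n] by simp
        then show ?thesis by simp
      qed
      finally show "ennreal ((2 ^ j * R) powr (- B)) * (\<integral>\<^sup>+x\<in>ball y (2 ^ j * (4 * R)). u x \<partial>lebesgue)
        \<le> ennreal (A * 8 ^ n / s * (2 powr (n - B)) ^ j) * c" .
    qed auto
    then show "(\<Sum>j. ennreal ((2 ^ j * R) powr (- B)) * (\<integral>\<^sup>+x\<in>ball y (2 ^ j * (4 * R)). u x \<partial>lebesgue))
        \<le> (\<Sum>j. ennreal (A * 8 ^ n / s * (2 powr (n - B)) ^ j)) * c"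
      by (simp only: ennreal_suminf_multc)
  qed
  also have "(\<Sum>j. ennreal (A * 8 ^ n / s * (2 powr (n - B)) ^ j))
      = ennreal (A * 8 ^ n / s / (1 - 2 powr (n - B)))"
    using A s Bn by (intro suminf_ennreal_geometric) (auto simp: powr_less_one)
  also have "ennreal (A * 4 ^ n / s) * c + ennreal (A * 4 powr B / s) * c
      + ennreal (A * 8 ^ n / s / (1 - 2 powr (n - B))) * c
      = ennreal (A * (4 ^ n + 4 powr B + 8 ^ n / (1 - 2 powr (n - B))) / s) * c"
  proof -
    define e where "e = 1 - 2 powr (n - B)"
    have e: "e > 0" using Bn by (simp add: e_def powr_less_one)
    have "ennreal (A * 4 ^ n / s) * c + ennreal (A * 4 powr B / s) * c + ennreal (A * 8 ^ n / s / e) * c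
        = ennreal (A * 4 ^ n / s + A * 4 powr B / s + A * 8 ^ n / s / e) * c"
      using A s e by (simp add: ennreal_plus distrib_right)
    also have "A * 4 ^ n / s + A * 4 powr B / s + A * 8 ^ n / s / e = A * (4 ^ n + 4 powr B + 8 ^ n / e) / s"
      using s e by (simp add: field_simps)
    finally show ?thesis by (simp add: e_def)
  qed
  finally show ?thesis by (simp add: E_def n_def)
qed

section \<open>Riesz potentials\<close>

lemma sigma_finite_lebesgue: "sigma_finite_measure (lebesgue :: 'a::euclidean_space measure)"
proof -
  obtain A :: "nat \<Rightarrow> 'a set" where "range A \<subseteq> sets lborel" "(\<Union>i. A i) = space lborel"
      "\<And>i. emeasure lborel (A i) \<noteq> \<infinity>"
    using lborel.sigma_finite by blast
  then show ?thesis
    by (intro sigma_finite_measure.intro exI[of _ "range A"]) (auto simp: subset_eq)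
qed

lemma measurable_ident_lebesgue: "(\<lambda>x::'a::euclidean_space. x) \<in> lebesgue \<rightarrow>\<^sub>M borel"
  by (simp add: measurable_completion)

text \<open>Normability is applied with the weighted measure on the \<open>x\<close> side and
  \<open>g\<close> as density on the \<open>y\<close> side, where the sections satisfy the bound of
  \<open>power_weight_kernel_bound\<close> with \<open>c = u y\<close>. Assuming only the ball bound
  allows the use of both an \<open>A_1\<close> weight and the constant weight 1.\<close>

lemma mixed_weak_type_riesz_potential:
  fixes u :: "'a::euclidean_space \<Rightarrow> ennreal" and \<alpha> \<beta> q A :: real
  assumes u [measurable]: "u \<in> borel_measurable lebesgue"
    and u_pos: "AE x in lebesgue. 0 < u x \<and> u x < \<infinity>"
    and A: "A > 0"
    and ball: "AE y in lebesgue. \<forall>r>0. (\<integral>\<^sup>+x\<in>ball y r. u x \<partial>lebesgue) \<le> ennreal (A * r ^ DIM('a)) * u y"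
    and \<alpha>: "0 < \<alpha>" "\<alpha> < real DIM('a)"
    and q: "q = real DIM('a) / (real DIM('a) - \<alpha>)"
    and \<beta>: "\<beta> * q < - real DIM('a)"
  obtains C where "C > 0"
    "\<And>g t X. \<lbrakk>g \<in> borel_measurable lebesgue; \<And>x. 0 \<le> g x; t > 0; X \<ge> 0;
        (\<integral>\<^sup>+y. ennreal (g y) * ennpowr (u y) (1 / q) \<partial>lebesgue) \<le> ennreal X\<rbrakk> \<Longrightarrow>
      (\<integral>\<^sup>+x\<in>{x. ennreal (t * norm x powr \<beta>) <
                  (\<integral>\<^sup>+y. ennreal (g y * norm (x - y) powr (\<alpha> - real DIM('a))) \<partial>lebesgue)}.
          u x * ennreal (norm x powr (\<beta> * q)) \<partial>lebesgue)
        \<le> ennreal ((C * X / t) powr q)"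
proof -
  define n where "n = DIM('a)"
  define B where "B = - \<beta> * q"
  have q1: "q > 1" using \<alpha> by (simp add: q)
  have B: "B > real n" using \<beta> by (simp add: B_def n_def)
  define k where "k = A * (4 ^ n + 4 powr B + 8 ^ n / (1 - 2 powr (real n - B)))"
  have "2 powr (real n - B) < 1" using B by (simp add: powr_less_one)
  then have k: "k > 0" using A by (auto simp: k_def intro!: mult_pos_pos add_pos_nonneg)
  define c where "c = 1 + 1 / (1 - 2 powr (1 - q))"
  have "2 powr (1 - q) < 1" using q1 by (auto simp: powr_less_one)
  then have c: "c > 0" by (simp add: c_def add_pos_pos)
  define w where "w x = u x * ennreal (norm x powr (\<beta> * q))" for x
  have id_leb [measurable]: "(\<lambda>x::'a. x) \<in> lebesgue \<rightarrow>\<^sub>M borel"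
    by (rule measurable_ident_lebesgue)
  have norm_leb [measurable]: "(\<lambda>x::'a. norm x) \<in> borel_measurable lebesgue"
    by (rule measurable_compose[OF id_leb]) simp
  have w [measurable]: "w \<in> borel_measurable lebesgue" unfolding w_def by measurable
  have AE0: "AE y in lebesgue. y \<noteq> (0::'a)"
    by (intro AE_I'[of "{0}"]) auto
  define M where "M = density lebesgue w"
  have "AE x in lebesgue. w x \<noteq> \<infinity>"
    using u_pos by eventually_elim (auto simp: w_def ennreal_mult_eq_top_iff)
  then have M: "sigma_finite_measure M"
    unfolding M_def
    by (subst sigma_finite_measure.sigma_finite_iff_density_finite[OF sigma_finite_lebesgue w])
  show ?thesis
  proof (rule that[of "c * k powr (1 / q)"])
    show "c * k powr (1 / q) > 0" using c k by simp
    fix g :: "'a \<Rightarrow> real" and t X :: real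
    assume g [measurable]: "g \<in> borel_measurable lebesgue" and g0: "\<And>x. 0 \<le> g x" and t: "t > 0"
      and X: "X \<ge> 0" and le: "(\<integral>\<^sup>+y. ennreal (g y) * ennpowr (u y) (1 / q) \<partial>lebesgue) \<le> ennreal X"
    define N where "N = density lebesgue (\<lambda>x. ennreal (g x))"
    \<comment> \<open>Division by the power weight is moved into the kernel, so the superlevel sets
      are taken at a constant height.\<close>
    define K where "K x y = norm (x - y) powr (\<alpha> - n) * norm x powr (- \<beta>)" for x y :: 'a
    define D where "D y = k * enn2real (u y)" for y
    have N: "sigma_finite_measure N"
      unfolding N_def
      by (subst sigma_finite_measure.sigma_finite_iff_density_finite[OF sigma_finite_lebesgue]) auto
    have K_sec: "(\<lambda>x. K x y) \<in> borel_measurable lebesgue" for y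
    proof -
      have "(\<lambda>x. K x y) \<in> borel_measurable borel" unfolding K_def by measurable
      then show ?thesis by (rule measurable_compose[OF id_leb])
    qed
    have K_sec': "(\<lambda>y. K x y) \<in> borel_measurable lebesgue" for x
    proof -
      have "(\<lambda>y. K x y) \<in> borel_measurable borel" unfolding K_def by measurable
      then show ?thesis by (rule measurable_compose[OF id_leb])
    qed
    have [measurable]: "(\<lambda>p. K (fst p) (snd p)) \<in> borel_measurable (M \<Otimes>\<^sub>M N)"
    proof -
      have "(\<lambda>x. x) \<in> M \<rightarrow>\<^sub>M borel" "(\<lambda>x. x) \<in> N \<rightarrow>\<^sub>M borel"
        using id_leb by (simp_all add: M_def N_def)
      then have "fst \<in> M \<Otimes>\<^sub>M N \<rightarrow>\<^sub>M borel" "snd \<in> M \<Otimes>\<^sub>M N \<rightarrow>\<^sub>M borel"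
        using measurable_compose[OF measurable_fst] measurable_compose[OF measurable_snd] by blast+
      then show ?thesis unfolding K_def by measurable
    qed
    have [measurable]: "D \<in> borel_measurable N"
      unfolding D_def N_def by simp
    have weak: "AE y in N. D y > 0 \<and>
        (\<forall>s>0. emeasure M {x \<in> space M. s < K x y} \<le> ennreal (D y * s powr (- q)))"
    proof -
      have "AE y in lebesgue. D y > 0 \<and>
        (\<forall>s>0. emeasure M {x \<in> space M. s < K x y} \<le> ennreal (D y * s powr (- q)))"
        using u_pos ball AE0
      proof eventually_elim
        case (elim y)
        have uy: "u y = ennreal (enn2real (u y))" "enn2real (u y) > 0"
          using elim(1) by (auto simp: enn2real_positive_iff)
        then have "D y > 0" using k by (simp add: D_def)
        moreover have "emeasure M {x \<in> space M. s < K x y} \<le> ennreal (D y * s powr (- q))" if s: "s > 0" for s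
        proof -
          \<comment> \<open>Since \<open>(\<alpha> - n) * q = - n\<close>, the \<open>q\<close>-th
            power of \<open>s < K x y\<close> is exactly the membership condition treated in
            \<open>power_weight_kernel_bound\<close>, with \<open>s powr q\<close> in place of
            \<open>s\<close>.\<close>
          have sub: "s powr q * norm (x - y) ^ n < norm x powr B" if "s < K x y" for x
          proof -
            have "K x y \<noteq> 0" using that s by auto
            then have nz: "norm (x - y) > 0" "norm x > 0" by (auto simp: K_def)
            have "s powr q < K x y powr q" using that s q1 by (intro powr_less_mono2) auto
            also have "K x y powr q = norm (x - y) powr ((\<alpha> - n) * q) * norm x powr B"
              by (simp add: K_def powr_mult powr_powr B_def)
            also have "(\<alpha> - n) * q = - real n"
              using \<alpha> by (simp add: q n_def field_simps)
            finally show ?thesis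
              using nz by (simp add: powr_minus powr_realpow field_simps)
          qed
          have "emeasure M {x \<in> space M. s < K x y} = (\<integral>\<^sup>+x\<in>{x. s < K x y}. w x \<partial>lebesgue)"
          proof -
            have "{x \<in> space lebesgue. s < K x y} \<in> sets lebesgue" using K_sec[of y] by measurable
            then show ?thesis unfolding M_def by (subst emeasure_density) auto
          qed
          also have "\<dots> \<le> (\<integral>\<^sup>+x\<in>{x. s powr q * norm (x - y) ^ n < norm x powr B}.
              u x * ennreal (norm x powr (- B)) \<partial>lebesgue)"
            using sub by (intro nn_integral_mono) (auto simp: indicator_def w_def B_def)
          also have "\<dots> \<le> ennreal (k / s powr q) * u y"
            using elim s B A unfolding k_def n_def by (intro power_weight_kernel_bound) auto
          also have "\<dots> = ennreal (k / s powr q) * ennreal (enn2real (u y))"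
            using uy(1) by simp
          also have "\<dots> = ennreal (D y * s powr (- q))"
            using k by (simp add: ennreal_mult[symmetric] D_def powr_minus_divide)
          finally show ?thesis .
        qed
        ultimately show ?case by blast
      qed
      then show ?thesis
        unfolding N_def by (subst AE_density) (auto elim: eventually_mono)
    qed
    have "(\<integral>\<^sup>+y. ennreal (D y powr (1 / q)) \<partial>N) = (\<integral>\<^sup>+y. ennreal (g y) * ennreal (D y powr (1 / q)) \<partial>lebesgue)"
      unfolding N_def D_def by (subst nn_integral_density) auto
    also have "\<dots> = (\<integral>\<^sup>+y. ennreal (k powr (1 / q)) * (ennreal (g y) * ennpowr (u y) (1 / q)) \<partial>lebesgue)"
    proof (rule nn_integral_cong_AE)
      show "AE y in lebesgue. ennreal (g y) * ennreal (D y powr (1 / q))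
          = ennreal (k powr (1 / q)) * (ennreal (g y) * ennpowr (u y) (1 / q))"
        using u_pos
      proof eventually_elim
        case (elim y)
        then have "u y \<noteq> \<infinity>" by auto
        then show ?case using k
          by (simp add: ennpowr_def D_def powr_mult ennreal_mult mult_ac)
      qed
    qed
    also have "\<dots> = ennreal (k powr (1 / q)) * (\<integral>\<^sup>+y. ennreal (g y) * ennpowr (u y) (1 / q) \<partial>lebesgue)"
      unfolding ennpowr_def by (intro nn_integral_cmult) measurable
    also have "\<dots> \<le> ennreal (k powr (1 / q)) * ennreal X" by (intro mult_left_mono le) simp
    also have "\<dots> = ennreal (k powr (1 / q) * X)" using X by (simp add: ennreal_mult)
    finally have "emeasure M {x \<in> space M. ennreal t < (\<integral>\<^sup>+y. ennreal (K x y) \<partial>N)}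
        \<le> ennreal ((c * (k powr (1 / q) * X) / t) powr q)"
      unfolding c_def using M N q1 t X weak by (intro weak_type_nn_integral_kernel) auto
    moreover have "(\<integral>\<^sup>+x\<in>{x. ennreal (t * norm x powr \<beta>) <
          (\<integral>\<^sup>+y. ennreal (g y * norm (x - y) powr (\<alpha> - n)) \<partial>lebesgue)}. w x \<partial>lebesgue)
        \<le> emeasure M {x \<in> space M. ennreal t < (\<integral>\<^sup>+y. ennreal (K x y) \<partial>N)}"
    proof -
      have sub: "ennreal t < (\<integral>\<^sup>+y. ennreal (K x y) \<partial>N)"
        if "ennreal (t * norm x powr \<beta>) < (\<integral>\<^sup>+y. ennreal (g y * norm (x - y) powr (\<alpha> - n)) \<partial>lebesgue)"
          (is "_ < ?I") and "x \<noteq> 0" for x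
      proof -
        have e: "norm x powr (- \<beta>) > 0" "norm x powr \<beta> * norm x powr (- \<beta>) = 1"
          using \<open>x \<noteq> 0\<close> by (auto simp: powr_add[symmetric])
        have "ennreal t = ennreal (norm x powr (- \<beta>)) * ennreal (t * norm x powr \<beta>)"
          using t e by (simp add: ennreal_mult[symmetric] mult_ac)
        also have "\<dots> < ennreal (norm x powr (- \<beta>)) * ?I"
          using e that by (intro ennreal_mult_strict_left_mono) auto
        also have "\<dots> = (\<integral>\<^sup>+y. ennreal (norm x powr (- \<beta>)) * ennreal (g y * norm (x - y) powr (\<alpha> - n)) \<partial>lebesgue)"
        proof (rule nn_integral_cmult[symmetric])
          have "(\<lambda>y. norm (x - y) powr (\<alpha> - n)) \<in> borel_measurable borel" by measurable
          then have [measurable]: "(\<lambda>y. norm (x - y) powr (\<alpha> - n)) \<in> borel_measurable lebesgue"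
            by (rule measurable_compose[OF id_leb])
          show "(\<lambda>y. ennreal (g y * norm (x - y) powr (\<alpha> - n))) \<in> borel_measurable lebesgue"
            by measurable
        qed
        also have "\<dots> = (\<integral>\<^sup>+y. ennreal (g y) * ennreal (K x y) \<partial>lebesgue)"
          using g0 by (simp add: ennreal_mult[symmetric] K_def mult_ac)
        also have "\<dots> = (\<integral>\<^sup>+y. ennreal (K x y) \<partial>N)"
          using K_sec'[of x] unfolding N_def by (subst nn_integral_density) auto
        finally show ?thesis .
      qed
      interpret N: sigma_finite_measure N by fact
      have "(\<lambda>x. \<integral>\<^sup>+y. ennreal (K x y) \<partial>N) \<in> borel_measurable M"
        by (intro N.borel_measurable_nn_integral) (simp add: case_prod_beta)
      then have [measurable]: "(\<lambda>x. \<integral>\<^sup>+y. ennreal (K x y) \<partial>N) \<in> borel_measurable lebesgue"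
        by (simp add: M_def)
      have "emeasure M {x \<in> space M. ennreal t < (\<integral>\<^sup>+y. ennreal (K x y) \<partial>N)}
        = (\<integral>\<^sup>+x\<in>{x. ennreal t < (\<integral>\<^sup>+y. ennreal (K x y) \<partial>N)}. w x \<partial>lebesgue)"
      proof -
        have "{x \<in> space lebesgue. ennreal t < (\<integral>\<^sup>+y. ennreal (K x y) \<partial>N)} \<in> sets lebesgue" by measurable
        then show ?thesis unfolding M_def by (subst emeasure_density) auto
      qed
      moreover have "(\<integral>\<^sup>+x\<in>{x. ennreal (t * norm x powr \<beta>) <
          (\<integral>\<^sup>+y. ennreal (g y * norm (x - y) powr (\<alpha> - n)) \<partial>lebesgue)}. w x \<partial>lebesgue)
        \<le> (\<integral>\<^sup>+x\<in>{x. ennreal t < (\<integral>\<^sup>+y. ennreal (K x y) \<partial>N)}. w x \<partial>lebesgue)"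
      proof (rule nn_integral_mono)
        fix x :: 'a
        show "w x * indicator {x. ennreal (t * norm x powr \<beta>) <
            (\<integral>\<^sup>+y. ennreal (g y * norm (x - y) powr (\<alpha> - n)) \<partial>lebesgue)} x
          \<le> w x * indicator {x. ennreal t < (\<integral>\<^sup>+y. ennreal (K x y) \<partial>N)} x"
          \<comment> \<open>At the origin \<open>0 powr p = 0\<close>, so \<open>w\<close> vanishes
            there and the inclusion of the sets is only required elsewhere.\<close>
          using sub[of x] by (cases "x = 0") (auto simp: indicator_def w_def)
      qed
      ultimately show ?thesis by simp
    qed
    ultimately show "(\<integral>\<^sup>+x\<in>{x. ennreal (t * norm x powr \<beta>) <
          (\<integral>\<^sup>+y. ennreal (g y * norm (x - y) powr (\<alpha> - real DIM('a))) \<partial>lebesgue)}.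
            u x * ennreal (norm x powr (\<beta> * q)) \<partial>lebesgue)
        \<le> ennreal ((c * k powr (1 / q) * X / t) powr q)"
      by (simp add: w_def n_def mult.assoc)
  qed
qed

text \<open>Follows from the weak type inequality with constant weight 1: the set of infinite
  potential has measure 0 for the density \<open>norm x powr (\<beta> * q)\<close>, which is
  positive off the origin. It ensures that the commutator is given by absolutely convergent
  integrals almost everywhere.\<close>

lemma riesz_potential_finite_AE:
  fixes g :: "'a::euclidean_space \<Rightarrow> real"
  assumes g [measurable]: "g \<in> borel_measurable lebesgue" and g0: "\<And>x. 0 \<le> g x"
    and int: "(\<integral>\<^sup>+y. ennreal (g y) \<partial>lebesgue) < \<infinity>"
    and \<gamma>: "0 < \<gamma>" "\<gamma> < real DIM('a)"
  shows "AE x in lebesgue. (\<integral>\<^sup>+y. ennreal (g y * norm (x - y) powr (\<gamma> - real DIM('a))) \<partial>lebesgue) < \<infinity>"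
proof -
  let ?n = "DIM('a)"
  define q where "q = real ?n / (real ?n - \<gamma>)"
  define \<beta> where "\<beta> = - real ?n - 1"
  \<comment> \<open>A ball of radius \<open>r\<close> has Lebesgue measure
    \<open>V * r ^ ?n\<close>, so the constant weight 1 meets the ball bound with
    \<open>A = V\<close>.\<close>
  define V where "V = unit_ball_vol (real ?n)"
  define J where "J x = (\<integral>\<^sup>+y. ennreal (g y * norm (x - y) powr (\<gamma> - real ?n)) \<partial>lebesgue)" for x
  have q1: "q > 1" using \<gamma> by (simp add: q_def)
  have V: "V > 0" by (simp add: V_def)
  have ball: "(\<integral>\<^sup>+x\<in>ball y r. 1 \<partial>lebesgue) \<le> ennreal (V * r ^ ?n) * 1" if "r > 0" for y :: 'a and r
    using that emeasure_ball[of r y] by (simp add: V_def)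
  have "real ?n * 1 < (real ?n + 1) * q" using q1 by (intro mult_strict_mono) auto
  then have \<beta>q: "\<beta> * q < - real ?n" by (simp add: \<beta>_def algebra_simps)
  obtain C where C: "C > 0" and weak: "\<And>g t X. \<lbrakk>g \<in> borel_measurable lebesgue; \<And>x. 0 \<le> g x; t > 0; X \<ge> 0;
        (\<integral>\<^sup>+y. ennreal (g y) * ennpowr 1 (1 / q) \<partial>lebesgue) \<le> ennreal X\<rbrakk> \<Longrightarrow>
      (\<integral>\<^sup>+x\<in>{x. ennreal (t * norm x powr \<beta>) <
                  (\<integral>\<^sup>+y. ennreal (g y * norm (x - y :: 'a) powr (\<gamma> - real ?n)) \<partial>lebesgue)}.
          1 * ennreal (norm x powr (\<beta> * q)) \<partial>lebesgue)
        \<le> ennreal ((C * X / t) powr q)"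
    using mixed_weak_type_riesz_potential[of "\<lambda>_::'a. 1" V \<gamma> q \<beta>] V ball \<gamma> \<beta>q q_def by auto
  \<comment> \<open>Adding 1 makes \<open>X\<close> positive, so that the level \<open>t\<close>
    chosen below is positive too.\<close>
  define X where "X = enn2real (\<integral>\<^sup>+y. ennreal (g y) \<partial>lebesgue) + 1"
  have X: "X > 0" "(\<integral>\<^sup>+y. ennreal (g y) \<partial>lebesgue) \<le> ennreal X"
    using int by (auto simp: X_def add_nonneg_pos ennreal_plus less_top[symmetric])
  define I where "I = (\<integral>\<^sup>+x. ennreal (norm x powr (\<beta> * q)) * indicator {x. J x = \<infinity>} x \<partial>lebesgue)"
  have I: "I \<le> ennreal ((C * X / t) powr q)" if t: "t > 0" for t
  proof -
    have "I \<le> (\<integral>\<^sup>+x\<in>{x. ennreal (t * norm x powr \<beta>) < J x}. 1 * ennreal (norm x powr (\<beta> * q)) \<partial>lebesgue)"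
      unfolding I_def by (intro nn_integral_mono) (auto simp: indicator_def)
    also have "\<dots> \<le> ennreal ((C * X / t) powr q)"
      unfolding J_def using g g0 t X by (intro weak) (auto simp: ennpowr_def)
    finally show ?thesis .
  qed
  \<comment> \<open>the set where the potential is infinite lies in every superlevel set; let \<open>t \<rightarrow> \<infinity>\<close>\<close>
  have "I = 0"
  proof (rule ccontr)
    assume "I \<noteq> 0"
    moreover have "I \<noteq> \<infinity>" using I[of 1] by (auto simp: top_unique)
    ultimately obtain e where e: "I = ennreal e" "e > 0"
      by (cases I) (auto simp: zero_less_iff_neq_zero)
    \<comment> \<open>Solves \<open>(C * X / t) powr q = e / 2\<close>, which contradicts
      \<open>I = e\<close>.\<close>
    define t where "t = C * X / (e / 2) powr (1 / q)"
    have "t > 0" using C X e by (simp add: t_def)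
    moreover have "(C * X / t) powr q = e / 2"
      using C X e q1 by (simp add: t_def powr_powr)
    ultimately have "ennreal e \<le> ennreal (e / 2)" using I[of t] e by simp
    then show False using e by simp
  qed
  have [measurable]: "(\<lambda>x::'a. norm x) \<in> borel_measurable lebesgue"
    by (rule measurable_compose[OF measurable_ident_lebesgue]) simp
  have [measurable]: "J \<in> borel_measurable lebesgue"
  proof -
    interpret sigma_finite_measure "lebesgue :: 'a measure" by (rule sigma_finite_lebesgue)
    have [measurable]: "fst \<in> (lebesgue :: 'a measure) \<Otimes>\<^sub>M (lebesgue :: 'a measure) \<rightarrow>\<^sub>M borel"
      "snd \<in> (lebesgue :: 'a measure) \<Otimes>\<^sub>M (lebesgue :: 'a measure) \<rightarrow>\<^sub>M borel"
      using measurable_compose[OF measurable_fst measurable_ident_lebesgue]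
        measurable_compose[OF measurable_snd measurable_ident_lebesgue] by blast+
    have "(\<lambda>p. norm (fst p - snd p) powr (\<gamma> - real ?n)) \<in> borel_measurable ((lebesgue :: 'a measure) \<Otimes>\<^sub>M lebesgue)"
      by measurable
    moreover have "(\<lambda>p. g (snd p)) \<in> borel_measurable ((lebesgue :: 'a measure) \<Otimes>\<^sub>M lebesgue)"
      by (rule measurable_compose[OF measurable_snd g])
    ultimately have "(\<lambda>p. ennreal (g (snd p) * norm (fst p - snd p) powr (\<gamma> - real ?n)))
        \<in> borel_measurable ((lebesgue :: 'a measure) \<Otimes>\<^sub>M lebesgue)"
      by measurable
    then show ?thesis unfolding J_def
      by (intro borel_measurable_nn_integral) (simp add: case_prod_beta)
  qed
  have "AE x in lebesgue. ennreal (norm x powr (\<beta> * q)) * indicator {x. J x = \<infinity>} x = 0"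
    using \<open>I = 0\<close> unfolding I_def by (subst (asm) nn_integral_0_iff_AE) auto
  moreover have "AE y in lebesgue. y \<noteq> (0::'a)"
    by (intro AE_I'[of "{0}"]) auto
  ultimately have "AE x in lebesgue. J x < \<infinity>"
    by eventually_elim (auto simp: indicator_def less_top split: if_splits)
  then show ?thesis by (simp add: J_def)
qed

section \<open>Commutators\<close>

lemma integrable_mult_bounded_on_support:
  fixes h c :: "'a \<Rightarrow> real"
  assumes "integrable M h" and [measurable]: "c \<in> borel_measurable M"
    and "\<And>y. h y \<noteq> 0 \<Longrightarrow> \<bar>c y\<bar> \<le> B"
  shows "integrable M (\<lambda>y. c y * h y)"
proof (rule Bochner_Integration.integrable_bound)
  show "integrable M (\<lambda>y. B * h y)" using assms(1) by simp
  show "(\<lambda>y. c y * h y) \<in> borel_measurable M" using assms(1) by measurable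
  have "\<bar>c y\<bar> * \<bar>h y\<bar> \<le> \<bar>B\<bar> * \<bar>h y\<bar>" for y
    using assms(3)[of y] by (cases "h y = 0") (auto intro!: mult_right_mono)
  then show "AE y in M. norm (c y * h y) \<le> norm (B * h y)" by (simp add: abs_mult)
qed

text \<open>The induction varies \<open>g\<close> because the recursion also evaluates the operator
  at \<open>b * g\<close>. The two integrals merge through \<open>b x - b y\<close>, raising the
  power by one. The bound on \<open>b\<close> over the support of \<open>g\<close> keeps both
  absolutely convergent, as the merging requires.\<close>

lemma iter_commutator_frac_integral:
  fixes b g :: "real ^ 'n \<Rightarrow> real"
  assumes b [measurable]: "b \<in> borel_measurable lebesgue"
    and "\<And>y. g y \<noteq> 0 \<Longrightarrow> \<bar>b y\<bar> \<le> B"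
    and "integrable lebesgue (\<lambda>y. g y / norm (x - y) powr (real CARD('n) - \<gamma>))"
  shows "iter_commutator m b (frac_integral \<gamma>) g x
    = (\<integral>y. (b x - b y) ^ m * (g y / norm (x - y) powr (real CARD('n) - \<gamma>)) \<partial>lebesgue)"
  using assms(2,3)
proof (induction m arbitrary: g)
  case 0
  then show ?case by (simp add: frac_integral_def)
next
  case (Suc m)
  let ?k = "\<lambda>y. norm (x - y) powr (real CARD('n) - \<gamma>)"
  have int_pow: "integrable lebesgue (\<lambda>y. (b x - b y) ^ m * (h y / ?k y))"
    if "\<And>y. h y \<noteq> 0 \<Longrightarrow> \<bar>b y\<bar> \<le> B" "integrable lebesgue (\<lambda>y. h y / ?k y)" for h
  proof (rule integrable_mult_bounded_on_support[OF that(2), where B = "(\<bar>b x\<bar> + B) ^ m"])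
    fix y assume "h y / ?k y \<noteq> 0"
    then have "\<bar>b x - b y\<bar> \<le> \<bar>b x\<bar> + B" using that(1)[of y] by auto
    then show "\<bar>(b x - b y) ^ m\<bar> \<le> (\<bar>b x\<bar> + B) ^ m"
      unfolding power_abs by (intro power_mono) auto
  qed measurable
  have bg: "integrable lebesgue (\<lambda>y. b y * g y / ?k y)"
    using integrable_mult_bounded_on_support[OF Suc.prems(2) b, of B] Suc.prems(1) by auto
  have bg0: "\<And>y. b y * g y \<noteq> 0 \<Longrightarrow> \<bar>b y\<bar> \<le> B" using Suc.prems(1) by auto
  have "iter_commutator (Suc m) b (frac_integral \<gamma>) g x
      = b x * (\<integral>y. (b x - b y) ^ m * (g y / ?k y) \<partial>lebesgue)
        - (\<integral>y. (b x - b y) ^ m * (b y * g y / ?k y) \<partial>lebesgue)"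
    using Suc.IH[OF Suc.prems] Suc.IH[OF bg0 bg] by (simp add: commutator_def)
  also have "\<dots> = (\<integral>y. b x * ((b x - b y) ^ m * (g y / ?k y)) - (b x - b y) ^ m * (b y * g y / ?k y) \<partial>lebesgue)"
  proof -
    have "integrable lebesgue (\<lambda>y. (b x - b y) ^ m * (g y / ?k y))"
      using Suc.prems by (rule int_pow)
    moreover have "integrable lebesgue (\<lambda>y. (b x - b y) ^ m * (b y * g y / ?k y))"
      using bg0 bg by (rule int_pow)
    ultimately show ?thesis
      by (subst Bochner_Integration.integral_diff) (auto simp only: integrable_mult_right integral_mult_right_zero)
  qed
  also have "\<dots> = (\<integral>y. (b x - b y) ^ Suc m * (g y / ?k y) \<partial>lebesgue)"
    by (intro Bochner_Integration.integral_cong) (auto simp: algebra_simps diff_divide_distrib)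
  finally show ?case .
qed

text \<open>A constant factor leaves the Bochner integral even when the integrand is not integrable
  and the integral takes its default value 0. Hence the first commutator vanishes for every
  \<open>g\<close>, and so do the later ones.\<close>

lemma iter_commutator_frac_integral_const:
  "iter_commutator (Suc m) (\<lambda>_. c) (frac_integral \<gamma>) g x = 0"
proof (induction m arbitrary: g x)
  case 0
  have "frac_integral \<gamma> (\<lambda>y. c * g y) x = c * frac_integral \<gamma> g x"
    unfolding frac_integral_def times_divide_eq_right[symmetric] by (rule integral_mult_right_zero)
  then show ?case by (simp add: commutator_def)
next
  case (Suc m)
  show ?case
    by (subst iter_commutator.simps(2)) (simp only: commutator_def Suc.IH mult_zero_right diff_zero)
qed

section \<open>Lipschitz functions and the pointwise bound for the commutator\<close>

text \<open>For \<open>x \<noteq> y\<close> the difference quotient is a lower bound of all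
  admissible constants, hence of their infimum. This covers constant \<open>b\<close>, whose infimum
  0 is not itself in \<open>Lipschitz_consts\<close>.\<close>

lemma Lambda_norm_bound:
  assumes "b \<in> Lambda_space \<delta>"
  shows "0 \<le> Lambda_norm \<delta> b" "\<bar>b x - b y\<bar> \<le> Lambda_norm \<delta> b * norm (x - y) powr \<delta>"
proof -
  have ne: "Lipschitz_consts \<delta> b \<noteq> {}" using assms by (simp add: Lambda_space_def)
  show "0 \<le> Lambda_norm \<delta> b"
    unfolding Lambda_norm_def by (intro cInf_greatest ne) (auto simp: Lipschitz_consts_def)
  show "\<bar>b x - b y\<bar> \<le> Lambda_norm \<delta> b * norm (x - y) powr \<delta>"
  proof (cases "x = y")
    case False
    then have d: "norm (x - y) powr \<delta> > 0" by simp
    have "\<bar>b x - b y\<bar> / norm (x - y) powr \<delta> \<le> Lambda_norm \<delta> b"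
      unfolding Lambda_norm_def
      by (intro cInf_greatest ne) (use d in \<open>auto simp: Lipschitz_consts_def divide_le_eq\<close>)
    then show ?thesis using d by (simp add: divide_le_eq)
  qed simp
qed

lemma Lambda_space_continuous:
  fixes b :: "real ^ 'n \<Rightarrow> real"
  assumes "b \<in> Lambda_space \<delta>" "\<delta> > 0"
  shows "continuous_on UNIV b"
proof -
  have "b \<midarrow>x\<rightarrow> b x" for x
  proof (rule LIM_zero_cancel, rule Lim_null_comparison)
    show "\<forall>\<^sub>F y in at x. norm (b y - b x) \<le> Lambda_norm \<delta> b * norm (y - x) powr \<delta>"
      using Lambda_norm_bound(2)[OF assms(1)] by simp
    have "(\<lambda>y. norm (y - x)) \<midarrow>x\<rightarrow> 0" by (rule LIM_offset_zero_cancel) (auto intro!: tendsto_eq_intros)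
    then have "(\<lambda>y. norm (y - x) powr \<delta>) \<midarrow>x\<rightarrow> 0"
      using assms(2) by (intro tendsto_zero_powrI[where b = \<delta>]) auto
    then show "(\<lambda>y. Lambda_norm \<delta> b * norm (y - x) powr \<delta>) \<midarrow>x\<rightarrow> 0"
      by (rule tendsto_mult_right_zero)
  qed
  then show ?thesis by (simp add: continuous_on_def)
qed

lemma ennpowr_inverse_le:
  assumes "a \<le> ennreal (z powr q)" "z \<ge> 0" "q > 0"
  shows "ennpowr a (1 / q) \<le> ennreal z"
proof -
  have a: "a \<noteq> \<infinity>" "enn2real a \<le> z powr q"
    using assms(1) enn2real_mono[OF assms(1)] by (auto simp: top_unique)
  then have "enn2real a powr (1 / q) \<le> (z powr q) powr (1 / q)"
    using assms(3) by (intro powr_mono2) auto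
  then show ?thesis using a assms by (simp add: ennpowr_def powr_powr ennreal_leI)
qed

text \<open>The factor \<open>(b x - b y) ^ m\<close> gains
  \<open>norm (x - y) powr (real m * \<delta>)\<close>, which raises the order of the potential from
  \<gamma> to \<open>\<gamma> + real m * \<delta>\<close>. The hypothesis \<open>fin\<close> at the
  point \<open>x\<close> makes the kernel formula for the commutator available there.\<close>

lemma iter_commutator_le_riesz_potential:
  fixes b h :: "real ^ 'n \<Rightarrow> real"
  assumes b: "b \<in> Lambda_space \<delta>" and \<delta>: "\<delta> > 0" and m: "m \<ge> 1"
    and h [measurable]: "h \<in> borel_measurable lebesgue" and supp: "bounded {y. h y \<noteq> 0}"
    and fin: "(\<integral>\<^sup>+y. ennreal (\<bar>h y\<bar> * norm (x - y) powr (\<gamma> - real CARD('n))) \<partial>lebesgue) < \<infinity>"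
  shows "ennreal \<bar>iter_commutator m b (frac_integral \<gamma>) h x\<bar>
    \<le> ennreal (Lambda_norm \<delta> b ^ m) *
        (\<integral>\<^sup>+y. ennreal (\<bar>h y\<bar> * norm (x - y) powr (\<gamma> + real m * \<delta> - real CARD('n))) \<partial>lebesgue)"
proof -
  define L where "L = Lambda_norm \<delta> b"
  have L: "L \<ge> 0" "\<And>x y. \<bar>b x - b y\<bar> \<le> L * norm (x - y) powr \<delta>"
    unfolding L_def by (rule Lambda_norm_bound[OF b])+
  have [measurable]: "b \<in> borel_measurable lebesgue"
    using borel_measurable_continuous_onI[OF Lambda_space_continuous[OF b \<delta>]]
    by (rule measurable_compose[OF measurable_ident_lebesgue])
  have kernel [measurable]: "(\<lambda>y. norm (x - y) powr p) \<in> borel_measurable lebesgue" for p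
    by (rule measurable_compose[OF measurable_ident_lebesgue]) measurable
  obtain R where R: "R > 0" "\<And>y. h y \<noteq> 0 \<Longrightarrow> norm y < R"
    using supp unfolding bounded_pos_less by auto
  have bB: "\<bar>b y\<bar> \<le> \<bar>b 0\<bar> + L * R powr \<delta>" if "h y \<noteq> 0" for y
  proof -
    have "\<bar>b y - b 0\<bar> \<le> L * norm y powr \<delta>" using L(2)[of y 0] by simp
    also have "\<dots> \<le> L * R powr \<delta>"
      using R(2)[OF that] L(1) \<delta> by (intro mult_left_mono powr_mono2) auto
    finally show ?thesis by linarith
  qed
  let ?k = "\<lambda>y. h y / norm (x - y) powr (real CARD('n) - \<gamma>)"
  have k: "\<bar>?k y\<bar> = \<bar>h y\<bar> * norm (x - y) powr (\<gamma> - real CARD('n))" for y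
    using powr_minus_divide[of "norm (x - y)" "real CARD('n) - \<gamma>"] by (simp add: abs_mult)
  have "integrable lebesgue ?k"
    using fin by (intro integrableI_bounded) (auto simp: k[symmetric])
  from iter_commutator_frac_integral[OF _ bB this, where m = m]
  have "ennreal \<bar>iter_commutator m b (frac_integral \<gamma>) h x\<bar>
      = ennreal (norm (\<integral>y. (b x - b y) ^ m * ?k y \<partial>lebesgue))" by simp
  also have "\<dots> \<le> (\<integral>\<^sup>+y. ennreal (norm ((b x - b y) ^ m * ?k y)) \<partial>lebesgue)"
  proof (rule integral_norm_bound_ennreal)
    show "integrable lebesgue (\<lambda>y. (b x - b y) ^ m * ?k y)"
    proof (rule integrable_mult_bounded_on_support[OF \<open>integrable lebesgue ?k\<close>,
          where B = "(\<bar>b x\<bar> + (\<bar>b 0\<bar> + L * R powr \<delta>)) ^ m"])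
      fix y assume "?k y \<noteq> 0"
      then have "\<bar>b x - b y\<bar> \<le> \<bar>b x\<bar> + (\<bar>b 0\<bar> + L * R powr \<delta>)" using bB[of y] by auto
      then show "\<bar>(b x - b y) ^ m\<bar> \<le> (\<bar>b x\<bar> + (\<bar>b 0\<bar> + L * R powr \<delta>)) ^ m"
        unfolding power_abs by (intro power_mono) auto
    qed measurable
  qed
  also have "\<dots> \<le> (\<integral>\<^sup>+y. ennreal (L ^ m) *
      ennreal (\<bar>h y\<bar> * norm (x - y) powr (\<gamma> + real m * \<delta> - real CARD('n))) \<partial>lebesgue)"
  proof (rule nn_integral_mono)
    fix y
    have "norm ((b x - b y) ^ m * ?k y) \<le> L ^ m * (\<bar>h y\<bar> * norm (x - y) powr (\<gamma> + real m * \<delta> - real CARD('n)))"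
    \<comment> \<open>On the diagonal both sides are 0, since \<open>0 powr p = 0\<close> and
      division by 0 gives 0.\<close>
    proof (cases "x = y")
      case False
      then have d: "norm (x - y) > 0" by simp
      have "\<bar>b x - b y\<bar> ^ m \<le> (L * norm (x - y) powr \<delta>) ^ m" by (intro power_mono L) simp
      also have "\<dots> = L ^ m * norm (x - y) powr (real m * \<delta>)"
        using d by (simp add: power_mult_distrib powr_realpow[symmetric] powr_powr mult.commute)
      finally have "\<bar>b x - b y\<bar> ^ m * \<bar>?k y\<bar> \<le> L ^ m * norm (x - y) powr (real m * \<delta>) * \<bar>?k y\<bar>"
        by (intro mult_right_mono) auto
      also have "\<dots> = L ^ m * (\<bar>h y\<bar> * (norm (x - y) powr (real m * \<delta>) * norm (x - y) powr (\<gamma> - real CARD('n))))"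
        unfolding k by (simp only: mult_ac)
      also have "norm (x - y) powr (real m * \<delta>) * norm (x - y) powr (\<gamma> - real CARD('n))
          = norm (x - y) powr (\<gamma> + real m * \<delta> - real CARD('n))"
        by (simp add: powr_add[symmetric] algebra_simps)
      finally show ?thesis by (simp only: real_norm_def abs_mult power_abs)
    qed simp
    then show "ennreal (norm ((b x - b y) ^ m * ?k y))
      \<le> ennreal (L ^ m) * ennreal (\<bar>h y\<bar> * norm (x - y) powr (\<gamma> + real m * \<delta> - real CARD('n)))"
      using L(1) by (simp add: ennreal_mult[symmetric] ennreal_leI)
  qed
  also have "\<dots> = ennreal (L ^ m) *
      (\<integral>\<^sup>+y. ennreal (\<bar>h y\<bar> * norm (x - y) powr (\<gamma> + real m * \<delta> - real CARD('n))) \<partial>lebesgue)"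
    by (intro nn_integral_cmult) measurable
  finally show ?thesis by (simp add: L_def)
qed

section \<open>The weak type inequality for the commutator\<close>

theorem theorem18:
  fixes m :: nat and \<gamma> \<delta> q \<beta> :: real
    and b :: "real ^ 'n \<Rightarrow> real" and u :: "real ^ 'n \<Rightarrow> ennreal" and v :: "real ^ 'n \<Rightarrow> real"
  assumes "m \<ge> 1"
    and "0 < \<gamma>" and "\<gamma> < real CARD('n)"
    and "0 < \<delta>" and "\<delta> < min 1 ((real CARD('n) - \<gamma>) / real m)"
    and "b \<in> Lambda_space \<delta>"
    and "q = real CARD('n) / (real CARD('n) - \<gamma> - real m * \<delta>)"
    and "A1_weight u"
    and "v = (\<lambda>x. norm x powr \<beta>)" and "\<beta> < - real CARD('n)"
  shows "\<exists>C::real. C > 0 \<and>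
    (\<forall>(t::real) (f :: real ^ 'n \<Rightarrow> real).
       t > 0 \<and> f \<in> borel_measurable lebesgue \<and> bounded (range f) \<and> compact (closure {x. f x \<noteq> 0}) \<longrightarrow>
       ennpowr
         (wmeasure (\<lambda>x. u x * ennreal (v x powr q))
            {x. \<bar>iter_commutator m b (frac_integral \<gamma>) (\<lambda>y. f y * v y) x\<bar> / v x > t})
         (1 / q)
       \<le> ennreal (C / t * Lambda_norm \<delta> b ^ m)
          * (\<integral>\<^sup>+x. ennreal \<bar>f x\<bar> * ennpowr (u x) (1 / q) * ennreal (v x) \<partial>lebesgue))"
proof -
  let ?n = "real CARD('n)"
  have dim: "DIM(real ^ 'n) = CARD('n)" by simp
  define \<alpha> where "\<alpha> = \<gamma> + real m * \<delta>"
  have "real m * \<delta> < ?n - \<gamma>" using assms(1,5) by (simp add: field_simps)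
  then have \<alpha>: "0 < \<alpha>" "\<alpha> < ?n" using assms(2,4) by (auto simp: \<alpha>_def add_pos_nonneg)
  have q: "q = ?n / (?n - \<alpha>)" by (simp add: assms(7) \<alpha>_def diff_diff_eq)
  have q1: "q > 1" using \<alpha> by (simp add: q)
  have "?n * 1 < (- \<beta>) * q" using q1 assms(10) by (intro mult_strict_mono) auto
  then have \<beta>q: "\<beta> * q < - ?n" by simp
  have u: "u \<in> borel_measurable lebesgue" "AE x in lebesgue. 0 < u x \<and> u x < \<infinity>"
    using assms(8) by (auto simp: A1_weight_def is_weight_def)
  obtain A where A: "A > 0"
    "AE y in lebesgue. \<forall>r>0. (\<integral>\<^sup>+x\<in>ball y r. u x \<partial>lebesgue) \<le> ennreal (A * r ^ CARD('n)) * u y"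
    using A1_weight_ball_bound[OF assms(8)] by blast
  obtain C where C: "C > 0" and weak: "\<And>g t X. \<lbrakk>g \<in> borel_measurable lebesgue; \<And>x. 0 \<le> g x; t > 0; X \<ge> 0;
        (\<integral>\<^sup>+y. ennreal (g y) * ennpowr (u y) (1 / q) \<partial>lebesgue) \<le> ennreal X\<rbrakk> \<Longrightarrow>
      (\<integral>\<^sup>+x\<in>{x. ennreal (t * norm x powr \<beta>) <
                  (\<integral>\<^sup>+y. ennreal (g y * norm (x - y) powr (\<alpha> - ?n)) \<partial>lebesgue)}.
          u x * ennreal (norm x powr (\<beta> * q)) \<partial>lebesgue)
        \<le> ennreal ((C * X / t) powr q)"
    apply (rule mixed_weak_type_riesz_potential[OF u A(1), unfolded dim, OF A(2) \<alpha> q \<beta>q])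
    subgoal premises p for C by (rule p(1)[OF p(2)], rule p(3))
    done
  define L where "L = Lambda_norm \<delta> b"
  have L0: "L \<ge> 0" unfolding L_def by (rule Lambda_norm_bound[OF assms(6)])
  have main: "ennpowr (wmeasure (\<lambda>x. u x * ennreal (v x powr q))
        {x. \<bar>iter_commutator m b (frac_integral \<gamma>) (\<lambda>y. f y * v y) x\<bar> / v x > t}) (1 / q)
      \<le> ennreal (C / t * L ^ m) * (\<integral>\<^sup>+x. ennreal \<bar>f x\<bar> * ennpowr (u x) (1 / q) * ennreal (v x) \<partial>lebesgue)"
    if t: "t > 0" and f [measurable]: "f \<in> borel_measurable lebesgue"
      and supp: "compact (closure {x. f x \<noteq> 0})" for t f
  proof -
    define T where "T = iter_commutator m b (frac_integral \<gamma>) (\<lambda>y. f y * v y)"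
    define I where "I = (\<integral>\<^sup>+x. ennreal \<bar>f x\<bar> * ennpowr (u x) (1 / q) * ennreal (v x) \<partial>lebesgue)"
    define E where "E = {x. \<bar>T x\<bar> / v x > t}"
    have v0: "v x \<ge> 0" for x by (simp add: assms(9))
    consider "L = 0" | "L > 0" "I = \<infinity>" | "L > 0" "I < \<infinity>"
      using L0 by (auto simp: less_top[symmetric] less_le)
    \<comment> \<open>\<open>f v\<close> need not be integrable near \<open>0\<close>, where the commutator would be built from junk values of
      the Bochner integral. If \<open>L > 0\<close> this forces \<open>I = \<infinity>\<close>; if \<open>L = 0\<close> the commutator vanishes anyway.\<close>
    then have "ennpowr (wmeasure (\<lambda>x. u x * ennreal (v x powr q)) E) (1 / q) \<le> ennreal (C / t * L ^ m) * I"
    proof cases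
      case 1
      have "b x = b 0" for x
        using Lambda_norm_bound(2)[OF assms(6), of x 0] 1 by (simp add: L_def)
      then have const: "b = (\<lambda>_. b 0)" by blast
      obtain k where k: "m = Suc k" using assms(1) by (cases m) auto
      have "T x = 0" for x
        unfolding T_def k by (subst const) (rule iter_commutator_frac_integral_const)
      then have "E = {}" using t by (simp add: E_def)
      then show ?thesis by (simp add: wmeasure_def ennpowr_def)
    next
      case 2
      then show ?thesis using C t by (simp add: ennreal_mult_top)
    next
      case 3
      define g where "g y = \<bar>f y\<bar> * v y" for y
      define X where "X = enn2real I"
      have X: "X \<ge> 0" "I = ennreal X" using 3 by (auto simp: X_def)
      have v [measurable]: "v \<in> borel_measurable lebesgue"
        unfolding assms(9) by (rule measurable_compose[OF measurable_ident_lebesgue]) measurable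
      have fv: "(\<lambda>y. f y * v y) \<in> borel_measurable lebesgue" by measurable
      have g [measurable]: "g \<in> borel_measurable lebesgue" unfolding g_def by measurable
      have g0: "g y \<ge> 0" and g_abs: "\<bar>f y * v y\<bar> = g y" for y
        using v0 by (auto simp: g_def abs_mult)
      have gI: "(\<integral>\<^sup>+y. ennreal (g y) * ennpowr (u y) (1 / q) \<partial>lebesgue) = ennreal X"
        unfolding X(2)[symmetric] I_def g_def using v0 by (intro nn_integral_cong) (simp add: ennreal_mult mult_ac)
      have bdd: "bounded {x. f x \<noteq> 0}"
        by (rule bounded_subset[OF compact_imp_bounded[OF supp] closure_subset])
      have supp_g: "bounded {x. g x \<noteq> 0}" "bounded {x. f x * v x \<noteq> 0}"
        by (rule bounded_subset[OF bdd]; auto simp: g_def)+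
      \<comment> \<open>Finiteness of \<open>I\<close> makes \<open>g\<close> integrable, hence its
        potential of order \<gamma> is finite almost everywhere, which is the condition for the
        pointwise bound on \<open>T\<close>.\<close>
      have "(\<integral>\<^sup>+y. ennreal (g y) \<partial>lebesgue) < \<infinity>"
        by (rule nn_integral_finite_of_A1_weight[OF assms(8) g supp_g(1), of "1 / q"]) (use q1 gI in simp_all)
      then have finite: "AE x in lebesgue. (\<integral>\<^sup>+y. ennreal (g y * norm (x - y) powr (\<gamma> - ?n)) \<partial>lebesgue) < \<infinity>"
        using riesz_potential_finite_AE[OF g g0 _ assms(2), unfolded dim] assms(3) by blast
      \<comment> \<open>The factor \<open>L ^ m\<close> is absorbed into the level and returns as
        \<open>C * X / s = C / t * L ^ m * X\<close>.\<close>
      define s where "s = t / L ^ m"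
      have s: "s > 0" using t 3 by (simp add: s_def)
      define J where "J x = (\<integral>\<^sup>+y. ennreal (g y * norm (x - y) powr (\<alpha> - ?n)) \<partial>lebesgue)" for x
      have "wmeasure (\<lambda>x. u x * ennreal (v x powr q)) E
          \<le> (\<integral>\<^sup>+x\<in>{x. ennreal (s * norm x powr \<beta>) < J x}. u x * ennreal (norm x powr (\<beta> * q)) \<partial>lebesgue)"
        unfolding wmeasure_def
      proof (rule nn_integral_mono_AE)
        show "AE x in lebesgue. u x * ennreal (v x powr q) * indicator E x
          \<le> u x * ennreal (norm x powr (\<beta> * q)) * indicator {x. ennreal (s * norm x powr \<beta>) < J x} x"
          using finite
        proof eventually_elim
          case (elim x)
          have TJ: "ennreal \<bar>T x\<bar> \<le> ennreal (L ^ m) * J x"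
            using iter_commutator_le_riesz_potential[OF assms(6,4,1) fv supp_g(2), of x \<gamma>] elim
            unfolding T_def L_def J_def \<alpha>_def g_abs by blast
          have "ennreal (s * norm x powr \<beta>) < J x" if "x \<in> E"
          proof (rule ccontr)
            assume "\<not> ennreal (s * norm x powr \<beta>) < J x"
            then have "ennreal (L ^ m) * J x \<le> ennreal (L ^ m) * ennreal (s * v x)"
              by (intro mult_left_mono) (auto simp: assms(9))
            also have "\<dots> = ennreal (t * v x)"
              by (subst ennreal_mult[symmetric]) (use 3 s t v0[of x] in \<open>auto simp: s_def\<close>)
            finally have "ennreal (L ^ m) * J x \<le> ennreal (t * v x)" .
            with TJ have "ennreal \<bar>T x\<bar> \<le> ennreal (t * v x)" by (rule order.trans)
            then have "\<bar>T x\<bar> \<le> t * v x" using t v0[of x] by (simp add: ennreal_le_iff)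
            \<comment> \<open>\<open>v\<close> vanishes at the origin, where the quotient defining
              \<open>E\<close> is 0 and cannot exceed \<open>t\<close>.\<close>
            moreover have "v x > 0"
              using that t v0[of x] by (cases "v x = 0") (auto simp: E_def)
            ultimately show False using that by (simp add: E_def less_divide_eq)
          qed
          then show ?case by (auto simp: indicator_def assms(9) powr_powr)
        qed
      qed
      also have "\<dots> \<le> ennreal ((C * X / s) powr q)"
        unfolding J_def by (rule weak[OF g g0 s X(1)]) (simp add: gI)
      finally have "ennpowr (wmeasure (\<lambda>x. u x * ennreal (v x powr q)) E) (1 / q) \<le> ennreal (C * X / s)"
        using C X s q1 by (intro ennpowr_inverse_le) auto
      also have "C * X / s = C / t * L ^ m * X" using t 3 by (simp add: s_def)
      also have "ennreal \<dots> = ennreal (C / t * L ^ m) * I"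
        unfolding X(2) using C t L0 X(1) by (intro ennreal_mult) auto
      finally show ?thesis .
    qed
    then show ?thesis by (simp add: E_def T_def I_def)
  qed
  show ?thesis
    using C main by (intro exI[of _ C]) (simp add: L_def)
qed

end
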